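(* Let $(X,d)$ be a compact, connected metric space with more than one point and $\mu$ a finite positive Borel measure of full support on $X$. (1) There is a constant $c>0$ such that for every $x_0\in X$ and $0<R<\mathrm{diam}(X)/2$, with $B=B_R[x_0]$, there exists $r_0>0$ such that for all $0<r<r_0$ the bottom $\sigma^B_r$ of the spectrum of $(I-W_r)^B$ on $L^2(B,\nu_r)$ satisfies $$\sigma^B_r\ \ge\ \frac{c}{E^+_{r,B}}.$$ (2) Suppose $(X,d,\mu)$ satisfies the variable time regularity condition $(E_\beta)$, with $\beta$ the local time exponent. Then there is a constant $c>0$ such that for every $x_0\in X$ and $0<R<\mathrm{diam}(X)/2$, with $B=B_R[x_0]$, there exists $r_0>0$ such that for all $0<r<r_0$ the bottom $\lambda^B_r$ of the spectrum of $\mathscr L_r^B$ on $L^2(B,\mu_r)$ satisfies $$\lambda^B_r\ \ge\ \frac{c}{R^{\beta(x_0)}}.$$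
   Context: $B_r(x)$ is the open ball and $B_r[x]=\{y:d(x,y)\le r\}$ the closed ball. Full support: $\mu(B_r(x))>0$ for all $x\in X,r>0$. Discrete walk and local time exponent. For $r>0$ let $v_r(x)=\mu(B_r(x))$, $a_r(x)=\frac1{\mu(B_r(x))}\int_{B_r(x)}\bigl(1+\frac{v_r(x)}{v_r(y)}\bigr)d\mu(y)$, $w_r(x,y)=\frac{1}{a_r(x)\mu(B_r(x))}\chi_{B_r(x)}(y)\bigl(1+\frac{v_r(x)}{v_r(y)}\bigr)$, $W_rf(x)=\int w_r(x,y)f(y)\,d\mu(y)$, and $d\nu_r=a_r\,d\mu$. Let $(\mathbf y(r)_k)_{k\ge0}$ be the discrete time Markov chain on $X$ with transition density $w_r(x,\cdot)$ with respect to $\mu$. For a closed ball $B$ let $E_{r,B}(x)=\mathbb E^x[\inf\{k\ge 0:\mathbf y(r)_k\notin B\}]$ and $E^+_{r,B}=\sup_{y\in B}E_{r,B}(y)$. For $\gamma>0$ let $T_\gamma(B)=\limsup_{r\to0^+}E^+_{r,B}r^\gamma$, $\beta(B)=\sup\{\gamma>0:T_\gamma(B)=\infty\}\in[0,\infty]$ (with $\sup\emptyset=0$), and $\beta(x)=\inf_{R>0}\beta(B_R[x])$. For part (2) it is assumed that $\beta$ is bounded above on $X$ (it is upper semicontinuous, hence Borel). Continuous time walk. For $r>0$ let $d_r(x)=\mu(B_r(x))r^{\beta(x)}$, $q_r(x)=\frac1{\mu(B_r(x))}\int_{B_r(x)}\bigl(1+\frac{d_r(x)}{d_r(y)}\bigr)d\mu(y)$,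 $p_r(x,y)=\frac{1}{q_r(x)\mu(B_r(x))}\chi_{B_r(x)}(y)\bigl(1+\frac{d_r(x)}{d_r(y)}\bigr)$, and $d\mu_r=q_r\,d\mu$. Let $(\mathbf x(r)_t)_{t\ge0}$ be the continuous time pure jump Markov process on $X$ that waits at $x$ an exponentially distributed time of mean $r^{\beta(x)}$ and then jumps to a point chosen with density $p_r(x,\cdot)$ with respect to $\mu$; minus its generator is $\mathscr L_rf(x)=\frac{1}{r^{\beta(x)}}\int_{B_r(x)}p_r(x,y)(f(x)-f(y))\,d\mu(y)$. For a closed ball $B$ let $\phi_{r,B}(x)=\mathbb E^x[\inf\{t:\mathbf x(r)_t\notin B\}]$, $\phi^+_{r,B}=\sup_{y\in B}\phi_{r,B}(y)$, $\mathcal T(B)=\limsup_{r\to0^+}\phi^+_{r,B}$. $(E_\beta)$ (variable time regularity): there is $C>0$ such that $\frac1C r^{\beta(x)}\le\mathcal T(B_r[x])\le Cr^{\beta(x)}$ for all $x\in X$ and $0<r<\mathrm{diam}(X)/2$. For an operator $A$ on $L^2(X,\mu)$, $A^B$ denotes the operator $\chi_BA\chi_B$ acting on functions on $B$ (extended by $0$ outside $B$). The operators $(I-W_r)^B$ and $\mathscr L^B_r$ are bounded and self-adjoint on $L^2(B,\nu_r)$ and $L^2(B,\mu_r)$ respectively. *)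

theory Defs
  imports "HOL-Probability.Probability"
begin

section \<open>Markov chains and jump processes on path space\<close>

text \<open>
  Law on \<open>nat \<Rightarrow> 'a\<close> of the discrete time Markov chain with transition kernel \<open>K\<close> started
  at \<open>x\<close>: the Ionescu-Tulcea projective limit whose coordinate \<open>0\<close> is \<open>x\<close> and whose
  coordinate \<open>n + 1\<close>, given the coordinates \<open>0, \<dots>, n\<close>, has law \<open>K\<close> at coordinate \<open>n\<close>.
\<close>

definition chain_step :: "('a::topological_space \<Rightarrow> 'a measure) \<Rightarrow> 'a \<Rightarrow> nat \<Rightarrow> (nat \<Rightarrow> 'a) \<Rightarrow> 'a measure"
  where "chain_step K x n \<omega> = (case n of 0 \<Rightarrow> return borel x | Suc m \<Rightarrow> K (\<omega> m))"

definition chain_law :: "('a::topological_space \<Rightarrow> 'a measure) \<Rightarrow> 'a \<Rightarrow> (nat \<Rightarrow> 'a) measure"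
  where "chain_law K x =
    projective_family.lim UNIV (Ionescu_Tulcea.CI (chain_step K x) (\<lambda>_. borel)) (\<lambda>_. borel)"

lemma Ionescu_Tulcea_chain_step:
  fixes K :: "'a::topological_space \<Rightarrow> 'a measure"
  assumes K: "K \<in> borel \<rightarrow>\<^sub>M prob_algebra borel"
  shows "Ionescu_Tulcea (chain_step K x) (\<lambda>_. borel)"
proof (rule Ionescu_Tulcea.intro)
  have K': "K \<in> borel \<rightarrow>\<^sub>M subprob_algebra borel"
    using K by (rule measurable_prob_algebraD)
  show "chain_step K x i \<in> Pi\<^sub>M {0..<i} (\<lambda>_. borel) \<rightarrow>\<^sub>M subprob_algebra borel" for i
  proof (cases i)
    case 0
    then have "chain_step K x i = (\<lambda>_. return borel x)"
      by (simp add: chain_step_def fun_eq_iff)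
    then show ?thesis
      by (simp add: space_subprob_algebra subprob_space_return)
  next
    case (Suc m)
    have "(\<lambda>\<omega>. \<omega> m) \<in> Pi\<^sub>M {0..<i} (\<lambda>_. borel :: 'a measure) \<rightarrow>\<^sub>M borel"
      using Suc by (intro measurable_component_singleton) simp
    from measurable_compose[OF this K'] show ?thesis
      using Suc by (simp add: chain_step_def[abs_def])
  qed
  show "prob_space (chain_step K x i \<omega>)" for i \<omega>
    using measurable_space[OF K]
    by (auto simp: chain_step_def space_prob_algebra prob_space_return split: nat.split)
qed

text \<open>Infima of times are taken in \<open>ennreal\<close>, so that a path which never leaves has exit time \<open>\<infinity>\<close>.\<close>

definition chain_exit_time :: "'a set \<Rightarrow> (nat \<Rightarrow> 'a) \<Rightarrow> ennreal"
  where "chain_exit_time B Y = (INF k\<in>{k. Y k \<notin> B}. of_nat k)"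

text \<open>
  A pure jump path is given by its successive positions \<open>Y\<close> and by independent standard
  exponential clocks \<open>e\<close>; the \<open>i\<close>-th holding time is \<open>h (Y i) * e i\<close>, which, given
  \<open>Y\<close>, is exponentially distributed with mean \<open>h (Y i)\<close>. The value of \<open>jump_path\<close> at time
  \<open>t\<close> is unspecified only if all jump times are at most \<open>t\<close>; for \<open>h\<close> bounded below by a positive
  constant this happens with probability zero.
\<close>

definition jump_time :: "('a \<Rightarrow> real) \<Rightarrow> (nat \<Rightarrow> 'a) \<Rightarrow> (nat \<Rightarrow> real) \<Rightarrow> nat \<Rightarrow> real"
  where "jump_time h Y e n = (\<Sum>i<n. h (Y i) * e i)"

definition jump_path :: "('a \<Rightarrow> real) \<Rightarrow> (nat \<Rightarrow> 'a) \<Rightarrow> (nat \<Rightarrow> real) \<Rightarrow> real \<Rightarrow> 'a"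
  where "jump_path h Y e t = Y (LEAST n. t < jump_time h Y e (Suc n))"

definition jump_exit_time :: "('a \<Rightarrow> real) \<Rightarrow> 'a set \<Rightarrow> (nat \<Rightarrow> 'a) \<Rightarrow> (nat \<Rightarrow> real) \<Rightarrow> ennreal"
  where "jump_exit_time h B Y e = (INF t\<in>{t. 0 \<le> t \<and> jump_path h Y e t \<notin> B}. ennreal t)"

definition exponential_clocks :: "(nat \<Rightarrow> real) measure"
  where "exponential_clocks = (\<Pi>\<^sub>M i\<in>UNIV. density lborel (\<lambda>t. ennreal (exponential_density 1 t)))"


section \<open>Symmetrized ball kernels\<close>

text \<open>
  The two walks differ only in the weight \<open>m\<close>: it is \<open>v\<^sub>r\<close> for the discrete
  time walk and \<open>d\<^sub>r\<close> for the continuous time walk.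
\<close>

definition ball_norm :: "'a::metric_space measure \<Rightarrow> real \<Rightarrow> ('a \<Rightarrow> real) \<Rightarrow> 'a \<Rightarrow> real"
  where "ball_norm \<mu> r m x =
    1 / measure \<mu> (ball x r) * (LINT y:ball x r|\<mu>. 1 + m x / m y)"

definition ball_density :: "'a::metric_space measure \<Rightarrow> real \<Rightarrow> ('a \<Rightarrow> real) \<Rightarrow> 'a \<Rightarrow> 'a \<Rightarrow> real"
  where "ball_density \<mu> r m x y =
    1 / (ball_norm \<mu> r m x * measure \<mu> (ball x r)) * indicator (ball x r) y * (1 + m x / m y)"

definition ball_kernel :: "'a::metric_space measure \<Rightarrow> real \<Rightarrow> ('a \<Rightarrow> real) \<Rightarrow> 'a \<Rightarrow> 'a measure"
  where "ball_kernel \<mu> r m x = density \<mu> (\<lambda>y. ennreal (ball_density \<mu> r m x y))"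

definition ball_measure :: "'a::metric_space measure \<Rightarrow> real \<Rightarrow> ('a \<Rightarrow> real) \<Rightarrow> 'a measure"
  where "ball_measure \<mu> r m = density \<mu> (\<lambda>x. ennreal (ball_norm \<mu> r m x))"


section \<open>The discrete time walk and the local time exponent\<close>

definition vol :: "'a::metric_space measure \<Rightarrow> real \<Rightarrow> 'a \<Rightarrow> real"
  where "vol \<mu> r x = measure \<mu> (ball x r)"

definition W_op :: "'a::metric_space measure \<Rightarrow> real \<Rightarrow> ('a \<Rightarrow> complex) \<Rightarrow> 'a \<Rightarrow> complex"
  where "W_op \<mu> r f x = (LINT y|\<mu>. ball_density \<mu> r (vol \<mu> r) x y *\<^sub>R f y)"

definition nu_measure :: "'a::metric_space measure \<Rightarrow> real \<Rightarrow> 'a measure"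
  where "nu_measure \<mu> r = ball_measure \<mu> r (vol \<mu> r)"

definition mean_exit :: "'a::metric_space measure \<Rightarrow> real \<Rightarrow> 'a set \<Rightarrow> 'a \<Rightarrow> ennreal"
  where "mean_exit \<mu> r B x =
    (\<integral>\<^sup>+ Y. chain_exit_time B Y \<partial>chain_law (ball_kernel \<mu> r (vol \<mu> r)) x)"

definition max_mean_exit :: "'a::metric_space measure \<Rightarrow> real \<Rightarrow> 'a set \<Rightarrow> ennreal"
  where "max_mean_exit \<mu> r B = (SUP y\<in>B. mean_exit \<mu> r B y)"

definition T_exp :: "'a::metric_space measure \<Rightarrow> real \<Rightarrow> 'a set \<Rightarrow> ennreal"
  where "T_exp \<mu> \<gamma> B = Limsup (at_right 0) (\<lambda>r. max_mean_exit \<mu> r B * ennreal (r powr \<gamma>))"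

definition time_exponent_set :: "'a::metric_space measure \<Rightarrow> 'a set \<Rightarrow> ennreal"
  where "time_exponent_set \<mu> B = (SUP \<gamma>\<in>{\<gamma>. 0 < \<gamma> \<and> T_exp \<mu> \<gamma> B = \<infinity>}. ennreal \<gamma>)"

definition time_exponent :: "'a::metric_space measure \<Rightarrow> 'a \<Rightarrow> ennreal"
  where "time_exponent \<mu> x = (INF R\<in>{0<..}. time_exponent_set \<mu> (cball x R))"


section \<open>The continuous time walk\<close>

text \<open>
  From here on the local time exponent is used as a real number; this is meaningful
  under the assumption \<open>time_exponent_bounded\<close> only.
\<close>

definition time_exponent_bounded :: "'a::metric_space measure \<Rightarrow> bool"
  where "time_exponent_bounded \<mu> \<longleftrightarrow> (\<exists>b::real. \<forall>x. time_exponent \<mu> x \<le> ennreal b)"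

definition beta :: "'a::metric_space measure \<Rightarrow> 'a \<Rightarrow> real"
  where "beta \<mu> x = enn2real (time_exponent \<mu> x)"

definition d_weight :: "'a::metric_space measure \<Rightarrow> real \<Rightarrow> 'a \<Rightarrow> real"
  where "d_weight \<mu> r x = measure \<mu> (ball x r) * r powr beta \<mu> x"

definition mu_measure :: "'a::metric_space measure \<Rightarrow> real \<Rightarrow> 'a measure"
  where "mu_measure \<mu> r = ball_measure \<mu> r (d_weight \<mu> r)"

definition L_op :: "'a::metric_space measure \<Rightarrow> real \<Rightarrow> ('a \<Rightarrow> complex) \<Rightarrow> 'a \<Rightarrow> complex"
  where "L_op \<mu> r f x = (1 / r powr beta \<mu> x) *\<^sub>R
    (LINT y:ball x r|\<mu>. ball_density \<mu> r (d_weight \<mu> r) x y *\<^sub>R (f x - f y))"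

definition mean_exit_ct :: "'a::metric_space measure \<Rightarrow> real \<Rightarrow> 'a set \<Rightarrow> 'a \<Rightarrow> ennreal"
  where "mean_exit_ct \<mu> r B x =
    (\<integral>\<^sup>+ \<omega>. jump_exit_time (\<lambda>z. r powr beta \<mu> z) B (fst \<omega>) (snd \<omega>)
       \<partial>(chain_law (ball_kernel \<mu> r (d_weight \<mu> r)) x \<Otimes>\<^sub>M exponential_clocks))"

definition max_mean_exit_ct :: "'a::metric_space measure \<Rightarrow> real \<Rightarrow> 'a set \<Rightarrow> ennreal"
  where "max_mean_exit_ct \<mu> r B = (SUP y\<in>B. mean_exit_ct \<mu> r B y)"

definition T_scale :: "'a::metric_space measure \<Rightarrow> 'a set \<Rightarrow> ennreal"
  where "T_scale \<mu> B = Limsup (at_right 0) (\<lambda>r. max_mean_exit_ct \<mu> r B)"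

definition variable_time_regular :: "'a::metric_space measure \<Rightarrow> bool"
  where "variable_time_regular \<mu> \<longleftrightarrow>
    (\<exists>C>0. \<forall>x r. 0 < r \<and> r < diameter (UNIV :: 'a set) / 2 \<longrightarrow>
       ennreal (1 / C * r powr beta \<mu> x) \<le> T_scale \<mu> (cball x r) \<and>
       T_scale \<mu> (cball x r) \<le> ennreal (C * r powr beta \<mu> x))"


section \<open>Spectra of operators on complex square integrable functions\<close>

text \<open>
  Elements of \<open>L\<^sup>2\<close> are represented by functions, and identities in \<open>L\<^sup>2\<close>
  hold almost everywhere. In \<open>L2_resolvent\<close> the inverse \<open>S\<close> is bounded; for a linear
  operator \<open>A\<close> it respects almost everywhere equality and is linear modulo it, because it is a
  bounded two-sided inverse.
\<close>

definition L2_fun :: "'a measure \<Rightarrow> ('a \<Rightarrow> complex) set"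
  where "L2_fun M = {f \<in> borel_measurable M. integrable M (\<lambda>x. (cmod (f x))\<^sup>2)}"

definition L2_nrm :: "'a measure \<Rightarrow> ('a \<Rightarrow> complex) \<Rightarrow> real"
  where "L2_nrm M f = sqrt (LINT x|M. (cmod (f x))\<^sup>2)"

definition L2_resolvent :: "'a measure \<Rightarrow> (('a \<Rightarrow> complex) \<Rightarrow> 'a \<Rightarrow> complex) \<Rightarrow> complex set"
  where "L2_resolvent M A = {z. \<exists>S C.
    (\<forall>g\<in>L2_fun M. S g \<in> L2_fun M \<and> L2_nrm M (S g) \<le> C * L2_nrm M g \<and>
       (AE x in M. A (S g) x - z * S g x = g x)) \<and>
    (\<forall>f\<in>L2_fun M. AE x in M. S (\<lambda>y. A f y - z * f y) x = f x)}"

definition L2_spectrum :: "'a measure \<Rightarrow> (('a \<Rightarrow> complex) \<Rightarrow> 'a \<Rightarrow> complex) \<Rightarrow> complex set"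
  where "L2_spectrum M A = - L2_resolvent M A"

text \<open>
  The operators considered are bounded and self-adjoint, so their spectra are real, bounded
  and nonempty; the infimum is taken in the extended reals only to avoid side conditions.
\<close>

definition spectrum_bottom :: "'a measure \<Rightarrow> (('a \<Rightarrow> complex) \<Rightarrow> 'a \<Rightarrow> complex) \<Rightarrow> ereal"
  where "spectrum_bottom M A = (INF z\<in>L2_spectrum M A. ereal (Re z))"

definition compress :: "'a set \<Rightarrow> (('a \<Rightarrow> complex) \<Rightarrow> 'a \<Rightarrow> complex) \<Rightarrow> ('a \<Rightarrow> complex) \<Rightarrow> 'a \<Rightarrow> complex"
  where "compress B A f x = indicator B x * A (\<lambda>y. indicator B y * f y) x"

definition sigma_bottom :: "'a::metric_space measure \<Rightarrow> real \<Rightarrow> 'a set \<Rightarrow> ereal"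
  where "sigma_bottom \<mu> r B = spectrum_bottom (restrict_space (nu_measure \<mu> r) B)
    (compress B (\<lambda>f x. f x - W_op \<mu> r f x))"

definition lambda_bottom :: "'a::metric_space measure \<Rightarrow> real \<Rightarrow> 'a set \<Rightarrow> ereal"
  where "lambda_bottom \<mu> r B = spectrum_bottom (restrict_space (mu_measure \<mu> r) B)
    (compress B (L_op \<mu> r))"

end

theory Submission
  imports Defs
begin

text \<open>
  Write \<open>P\<close> for the transition operator killed outside \<open>B\<close> and \<open>\<tau>\<close> for the mean
  holding time (\<open>1\<close> for the discrete walk), so that the operator is \<open>(I - P) / \<tau>\<close>.
  The Green function \<open>G = \<tau> + P \<tau> + P (P \<tau>) + \<dots>\<close> solves \<open>G = \<tau> + P G\<close> and is at most
  the mean exit time \<open>E\<close>; hence \<open>(G - P G) / \<tau> = 1 \<ge> G / sup E\<close>, that is, \<open>G\<close> is a positive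
  supersolution with rate \<open>\<theta> = 1 / sup E\<close> (if \<open>sup E = \<infinity>\<close>, take the constant \<open>1\<close> and \<open>\<theta> = 0\<close>).
  For \<open>Re z < \<theta>\<close> the operator \<open>P / (1 - z \<tau>)\<close> is then a strict contraction in the
  supremum norm weighted by \<open>1 / G\<close>, and since for fixed \<open>r\<close> its kernel is bounded, it maps
  \<open>L\<^sup>2\<close> into the bounded functions. So the Neumann series gives a bounded inverse on \<open>L\<^sup>2\<close>,
  without using self-adjointness. In part (2), \<open>sup E\<close> is at most \<open>2 C R\<^sup>\<beta>\<close> for small \<open>r\<close> by
  the upper bound in the time regularity condition.
\<close>

section \<open>Exit times and the killed transition operator\<close>

text \<open>The product with index \<open>n\<close> is 1 as long as the positions up to time
  \<open>n\<close> lie in \<open>B\<close>, so the series counts the steps before the first exit. A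
  measurable lower bound on the exit time is enough later, because \<open>nn_integral\<close> is
  monotone for arbitrary functions.\<close>

lemma chain_exit_time_ge: "(\<Sum>n. \<Prod>i\<le>n. indicator B (Y i)) \<le> chain_exit_time B Y"
  unfolding chain_exit_time_def
proof (rule INF_greatest)
  fix k assume "k \<in> {k. Y k \<notin> B}"
  then have 0: "(\<Prod>i\<le>n. indicator B (Y i) :: ennreal) = 0" if "k \<le> n" for n
    using that by (intro prod_zero) (auto intro!: bexI[of _ k])
  have 1: "(\<Prod>i\<le>n. indicator B (Y i) :: ennreal) \<le> 1" for n
    by (intro prod_le_1) (auto split: split_indicator)
  have "(\<Sum>n. \<Prod>i\<le>n. indicator B (Y i) :: ennreal) = (\<Sum>n<k. \<Prod>i\<le>n. indicator B (Y i))"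
    using 0 by (intro suminf_finite) auto
  also have "\<dots> \<le> of_nat (card {..<k}) * 1"
    using 1 by (intro sum_bounded_above) auto
  finally show "(\<Sum>n. \<Prod>i\<le>n. indicator B (Y i) :: ennreal) \<le> of_nat k"
    by simp
qed

text \<open>The indicator tests the point of arrival only; membership of the starting point in
  \<open>B\<close> is carried separately. Values in \<open>ennreal\<close> let iterates and infinite
  sums be formed without integrability conditions.\<close>

definition killed :: "('a \<Rightarrow> 'a measure) \<Rightarrow> 'a set \<Rightarrow> ('a \<Rightarrow> ennreal) \<Rightarrow> 'a \<Rightarrow> ennreal"
  where "killed K B f x = (\<integral>\<^sup>+ y. indicator B y * f y \<partial>K x)"

section \<open>Path integrals of the discrete chain as iterates of the killed operator\<close>

context
  fixes K :: "'a::topological_space \<Rightarrow> 'a measure" and B :: "'a set"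
  assumes K: "K \<in> borel \<rightarrow>\<^sub>M prob_algebra borel" and B[measurable]: "B \<in> sets borel"
begin

lemma kernel_subprob: "K \<in> borel \<rightarrow>\<^sub>M subprob_algebra borel"
  using K by (rule measurable_prob_algebraD)

lemma measurable_killed [measurable]:
  "f \<in> borel_measurable borel \<Longrightarrow> killed K B f \<in> borel_measurable borel"
  unfolding killed_def[abs_def]
  by (rule measurable_compose[OF kernel_subprob nn_integral_measurable_subprob_algebra]) measurable

lemma measurable_killed_iterate [measurable]:
  "f \<in> borel_measurable borel \<Longrightarrow> (killed K B ^^ n) f \<in> borel_measurable borel"
  by (induction n) auto

lemma sets_chain_law: "sets (chain_law K x) = sets (PiM UNIV (\<lambda>_. borel))"
proof -
  interpret IT: Ionescu_Tulcea "chain_step K x" "\<lambda>_. borel"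
    by (rule Ionescu_Tulcea_chain_step[OF K])
  show ?thesis
    unfolding chain_law_def by simp
qed

lemma measurable_chain_law_component:
  assumes "f \<in> borel_measurable borel"
  shows "(\<lambda>Y. f (Y i)) \<in> borel_measurable (chain_law K x)"
proof -
  have "(\<lambda>Y. Y i) \<in> chain_law K x \<rightarrow>\<^sub>M borel"
    unfolding measurable_cong_sets[OF sets_chain_law refl]
    by (rule measurable_component_singleton) simp
  then show ?thesis
    using assms by (rule measurable_compose)
qed

text \<open>The path law is a projective limit, known through its finite marginals. This passes to
  the law of the first \<open>n\<close> coordinates, which is built by successive kernel steps and
  can be integrated one step at a time.\<close>

lemma nn_integral_chain_law_restrict:
  assumes f: "f \<in> borel_measurable (PiM {0..<n} (\<lambda>_. borel))"
  shows "(\<integral>\<^sup>+ Y. f (restrict Y {0..<n}) \<partial>chain_law K x) =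
    (\<integral>\<^sup>+ \<omega>. f \<omega> \<partial>Ionescu_Tulcea.C (chain_step K x) (\<lambda>_. borel) 0 n (\<lambda>_. undefined))"
proof -
  interpret IT: Ionescu_Tulcea "chain_step K x" "\<lambda>_. borel"
    by (rule Ionescu_Tulcea_chain_step[OF K])
  have le: "n \<le> IT.up_to {0..<n}"
    by (cases n) (auto simp: Suc_le_eq intro!: IT.up_to_less)
  have "IT.C 0 n (\<lambda>_. undefined) = IT.CI {0..<n}"
    using IT.distr_C[OF le, of "\<lambda>_. undefined" 0] by (simp add: IT.CI_def space_PiM)
  also have "\<dots> = distr (chain_law K x) (PiM {0..<n} (\<lambda>_. borel)) (\<lambda>Y. restrict Y {0..<n})"
    unfolding chain_law_def by (simp add: IT.distr_lim)
  finally have "IT.C 0 n (\<lambda>_. undefined) =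
    distr (chain_law K x) (PiM {0..<n} (\<lambda>_. borel)) (\<lambda>Y. restrict Y {0..<n})" .
  then show ?thesis
    using f by (simp add: nn_integral_distr measurable_cong_sets[OF sets_chain_law refl]
        measurable_restrict_subset)
qed

text \<open>Markov property at time \<open>n\<close>: given the earlier coordinates, coordinate
  \<open>Suc n\<close> has law \<open>K (Y n)\<close>, and integrating it out turns the last time
  step into one application of \<open>killed\<close>.\<close>

lemma nn_integral_chain_law_Suc:
  assumes f[measurable]: "f \<in> borel_measurable borel"
  shows "(\<integral>\<^sup>+ Y. (\<Prod>i\<le>Suc n. indicator B (Y i)) * f (Y (Suc n)) \<partial>chain_law K x) =
    (\<integral>\<^sup>+ Y. (\<Prod>i\<le>n. indicator B (Y i)) * killed K B f (Y n) \<partial>chain_law K x)"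
proof -
  interpret IT: Ionescu_Tulcea "chain_step K x" "\<lambda>_. borel"
    by (rule Ionescu_Tulcea_chain_step[OF K])
  let ?u = "\<lambda>_::nat. undefined :: 'a"
  let ?F = "\<lambda>\<omega>. (\<Prod>i\<le>Suc n. indicator B (\<omega> i)) * f (\<omega> (Suc n))"
  let ?G = "\<lambda>\<omega>. (\<Prod>i\<le>n. indicator B (\<omega> i)) * killed K B f (\<omega> n)"
  have comp: "(\<lambda>\<omega>. g (\<omega> i)) \<in> borel_measurable (PiM {0..<m} (\<lambda>_. borel :: 'a measure))"
    if "g \<in> borel_measurable borel" "i < m" for g :: "'a \<Rightarrow> ennreal" and i m :: nat
    using that by (intro measurable_compose[OF measurable_component_singleton]) auto
  \<comment> \<open>Time \<open>Suc n\<close> involves \<open>Suc (Suc n)\<close> coordinates: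
    coordinate \<open>0\<close> is drawn as well, from the Dirac mass at \<open>x\<close>, and the
    construction starts from the empty path \<open>?u\<close>.\<close>
  have F: "?F \<in> borel_measurable (PiM {0..<Suc (Suc n)} (\<lambda>_. borel))"
    by (intro borel_measurable_times_ennreal borel_measurable_prod_ennreal comp
        borel_measurable_indicator f B) simp_all
  have G: "?G \<in> borel_measurable (PiM {0..<Suc n} (\<lambda>_. borel))"
    by (intro borel_measurable_times_ennreal borel_measurable_prod_ennreal comp
        borel_measurable_indicator measurable_killed f B) simp_all
  have u: "?u \<in> space (PiM {0..<0} (\<lambda>_. borel))"
    by (simp add: space_PiM)
  have "(\<integral>\<^sup>+ Y. ?F Y \<partial>chain_law K x) = (\<integral>\<^sup>+ \<omega>. ?F \<omega> \<partial>IT.C 0 (Suc (Suc n)) ?u)"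
    by (subst nn_integral_chain_law_restrict[OF F, symmetric]) simp
  also have "\<dots> = (\<integral>\<^sup>+ \<omega>. (\<integral>\<^sup>+ \<omega>'. ?F \<omega>' \<partial>IT.eP (Suc n) \<omega>) \<partial>IT.C 0 (Suc n) ?u)"
    unfolding IT.C.simps(2)[of 0 "Suc n"] add_0
    by (rule nn_integral_bind[OF F]) (unfold measurable_cong_sets[OF IT.sets_C[OF u, of "Suc n"] refl],
        unfold add_0, rule IT.measurable_eP)
  also have "\<dots> = (\<integral>\<^sup>+ \<omega>. ?G \<omega> \<partial>IT.C 0 (Suc n) ?u)"
  proof (rule nn_integral_cong)
    fix \<omega> assume "\<omega> \<in> space (IT.C 0 (Suc n) ?u)"
    then have \<omega>: "\<omega> \<in> space (PiM {0..<Suc n} (\<lambda>_. borel))"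
      using IT.space_C[OF u, of "Suc n"] by (simp del: IT.C.simps)
    have sK: "sets (K z) = sets borel" for z
      using subprob_measurableD(2)[OF kernel_subprob, of z] by simp
    have "(\<integral>\<^sup>+ \<omega>'. ?F \<omega>' \<partial>IT.eP (Suc n) \<omega>) = (\<integral>\<^sup>+ y. ?F (fun_upd \<omega> (Suc n) y) \<partial>chain_step K x (Suc n) \<omega>)"
      by (rule IT.nn_integral_eP[OF \<omega> F])
    also have "\<dots> = (\<integral>\<^sup>+ y. (\<Prod>i\<le>n. indicator B (\<omega> i)) * (indicator B y * f y) \<partial>K (\<omega> n))"
      by (simp add: chain_step_def mult_ac)
    also have "\<dots> = ?G \<omega>"
      unfolding killed_def by (rule nn_integral_cmult) (simp add: measurable_cong_sets[OF sK refl])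
    finally show "(\<integral>\<^sup>+ \<omega>'. ?F \<omega>' \<partial>IT.eP (Suc n) \<omega>) = ?G \<omega>" .
  qed
  also have "\<dots> = (\<integral>\<^sup>+ Y. ?G Y \<partial>chain_law K x)"
    by (subst nn_integral_chain_law_restrict[OF G, symmetric]) simp
  finally show ?thesis .
qed

lemma nn_integral_chain_law_0:
  assumes f[measurable]: "f \<in> borel_measurable borel"
  shows "(\<integral>\<^sup>+ Y. f (Y 0) \<partial>chain_law K x) = f x"
proof -
  interpret IT: Ionescu_Tulcea "chain_step K x" "\<lambda>_. borel"
    by (rule Ionescu_Tulcea_chain_step[OF K])
  let ?u = "\<lambda>_::nat. undefined :: 'a"
  have F: "(\<lambda>\<omega>. f (\<omega> 0)) \<in> borel_measurable (PiM {0..<Suc 0} (\<lambda>_. borel))"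
    by (intro measurable_compose[OF _ f] measurable_component_singleton) simp
  have u: "?u \<in> space (PiM {0..<0} (\<lambda>_. borel))"
    by (simp add: space_PiM)
  have "(\<integral>\<^sup>+ Y. f (Y 0) \<partial>chain_law K x) = (\<integral>\<^sup>+ \<omega>. f (\<omega> 0) \<partial>IT.C 0 (Suc 0) ?u)"
    by (subst nn_integral_chain_law_restrict[OF F, symmetric]) simp
  also have "\<dots> = (\<integral>\<^sup>+ \<omega>. (\<integral>\<^sup>+ \<omega>'. f (\<omega>' 0) \<partial>IT.eP 0 \<omega>) \<partial>IT.C 0 0 ?u)"
    unfolding IT.C.simps(2) add_0
    by (rule nn_integral_bind[OF F]) (unfold measurable_cong_sets[OF IT.sets_C[OF u, of 0] refl],
        unfold add_0, rule IT.measurable_eP)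
  also have "\<dots> = (\<integral>\<^sup>+ \<omega>'. f (\<omega>' 0) \<partial>IT.eP 0 ?u)"
    unfolding IT.C.simps(1)
    by (rule nn_integral_return[OF u
        measurable_compose[OF IT.measurable_eP nn_integral_measurable_subprob_algebra[OF F]]])
  also have "\<dots> = (\<integral>\<^sup>+ y. f (fun_upd ?u 0 y 0) \<partial>chain_step K x 0 ?u)"
    by (rule IT.nn_integral_eP[OF u F])
  also have "\<dots> = f x"
    by (simp add: chain_step_def nn_integral_return)
  finally show ?thesis .
qed

text \<open>Trading time steps for applications of \<open>killed\<close> leaves time
  \<open>0\<close>, hence the indicator of the start. The induction keeps \<open>f\<close> arbitrary
  since each step replaces it by \<open>killed K B f\<close>. For \<open>f = 1\<close> this is the
  probability of staying in \<open>B\<close> through time \<open>n\<close>.\<close>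

lemma nn_integral_chain_law_killed:
  "f \<in> borel_measurable borel \<Longrightarrow>
    (\<integral>\<^sup>+ Y. (\<Prod>i\<le>n. indicator B (Y i)) * f (Y n) \<partial>chain_law K x) =
    indicator B x * (killed K B ^^ n) f x"
proof (induction n arbitrary: f)
  case 0
  then show ?case
    using nn_integral_chain_law_0[of "\<lambda>y. indicator B y * f y" x] by simp
next
  case (Suc n)
  then show ?case
    by (simp add: nn_integral_chain_law_Suc funpow_swap1 del: prod.atMost_Suc funpow.simps)
      (simp add: funpow_swap1)
qed

text \<open>The Green function equation: the integral commutes with the sum of nonnegative terms, so
  applying \<open>killed\<close> shifts the series by one. It holds also where the sum is
  infinite.\<close>

lemma sum_killed_fixpoint:
  assumes f[measurable]: "f \<in> borel_measurable borel"
  shows "(\<Sum>n. (killed K B ^^ n) f x) = f x + killed K B (\<lambda>y. \<Sum>n. (killed K B ^^ n) f y) x"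
proof -
  have sK: "sets (K z) = sets borel" for z
    using subprob_measurableD(2)[OF kernel_subprob, of z] by simp
  have "killed K B (\<lambda>y. \<Sum>n. (killed K B ^^ n) f y) x =
      (\<integral>\<^sup>+ y. (\<Sum>n. indicator B y * (killed K B ^^ n) f y) \<partial>K x)"
    by (simp add: killed_def)
  also have "\<dots> = (\<Sum>n. (killed K B ^^ Suc n) f x)"
    by (subst nn_integral_suminf) (simp_all add: measurable_cong_sets[OF sK refl] killed_def)
  finally show ?thesis
    using suminf_offset[of "\<lambda>n. (killed K B ^^ n) f x" 1] by simp
qed

text \<open>Tail sum formula: the expected exit time dominates the sum over \<open>n\<close> of the
  probabilities of staying in \<open>B\<close> through time \<open>n\<close>.\<close>

lemma nn_integral_chain_exit_time_ge:
  assumes "x \<in> B"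
  shows "(\<Sum>n. (killed K B ^^ n) (\<lambda>_. 1) x) \<le> (\<integral>\<^sup>+ Y. chain_exit_time B Y \<partial>chain_law K x)"
proof -
  have [measurable]: "(\<lambda>Y. indicator B (Y i) :: ennreal) \<in> borel_measurable (chain_law K x)" for i
    by (rule measurable_chain_law_component) simp
  have "(\<Sum>n. (killed K B ^^ n) (\<lambda>_. 1) x) =
      (\<Sum>n. (\<integral>\<^sup>+ Y. (\<Prod>i\<le>n. indicator B (Y i)) \<partial>chain_law K x))"
    using nn_integral_chain_law_killed[of "\<lambda>_. 1"] assms by simp
  also have "\<dots> = (\<integral>\<^sup>+ Y. (\<Sum>n. \<Prod>i\<le>n. indicator B (Y i)) \<partial>chain_law K x)"
    by (rule nn_integral_suminf[symmetric]) measurable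
  also have "\<dots> \<le> (\<integral>\<^sup>+ Y. chain_exit_time B Y \<partial>chain_law K x)"
    by (intro nn_integral_mono chain_exit_time_ge)
  finally show ?thesis .
qed

end

section \<open>Exit times of jump paths and exponential clocks\<close>

text \<open>Before a path can be seen outside \<open>B\<close>, the holding times at all positions
  preceding the first one outside \<open>B\<close> must have elapsed. The left side adds up exactly
  these holding times.\<close>

lemma jump_exit_time_ge:
  assumes h: "\<And>x. 0 \<le> h x" and e: "\<And>i. 0 \<le> e i"
  shows "(\<Sum>n. (\<Prod>i\<le>n. indicator B (Y i)) * ennreal (h (Y n)) * ennreal (e n)) \<le> jump_exit_time h B Y e"
  unfolding jump_exit_time_def
proof (rule INF_greatest)
  fix t assume "t \<in> {t. 0 \<le> t \<and> jump_path h Y e t \<notin> B}"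
  then have t: "0 \<le> t" "jump_path h Y e t \<notin> B" by auto
  let ?s = "\<lambda>n. (\<Prod>i\<le>n. indicator B (Y i)) * ennreal (h (Y n)) * ennreal (e n)"
  have 1: "(\<Prod>i\<le>n. indicator B (Y i) :: ennreal) \<le> 1" for n
    by (intro prod_le_1) (auto split: split_indicator)
  have part: "(\<Sum>n<m. ?s n) \<le> ennreal (jump_time h Y e m)" for m
  proof -
    have "?s n \<le> ennreal (h (Y n) * e n)" for n
      using mult_right_mono[OF 1[of n], of "ennreal (h (Y n) * e n)"]
      unfolding ennreal_mult[OF h e] by (simp add: mult.assoc)
    then have "(\<Sum>n<m. ?s n) \<le> (\<Sum>n<m. ennreal (h (Y n) * e n))"
      by (intro sum_mono)
    also have "\<dots> = ennreal (jump_time h Y e m)"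
      using h e by (simp add: jump_time_def)
    finally show ?thesis .
  qed
  show "(\<Sum>n. ?s n) \<le> ennreal t"
  proof (cases "\<exists>n. t < jump_time h Y e (Suc n)")
    case True
    \<comment> \<open>\<open>L\<close> is the index of the position occupied at time
      \<open>t\<close>. Since \<open>Y L\<close> is outside \<open>B\<close>, the terms from
      \<open>L\<close> on vanish, and the first \<open>L\<close> holding times are over by time
      \<open>t\<close>.\<close>
    define L where "L = (LEAST n. t < jump_time h Y e (Suc n))"
    have Y: "Y L \<notin> B"
      using t(2) by (simp add: jump_path_def L_def)
    have JL: "jump_time h Y e L \<le> t"
    proof (cases L)
      case 0
      then show ?thesis using t(1) by (simp add: jump_time_def)
    next
      case (Suc l)
      then have "\<not> t < jump_time h Y e (Suc l)"
        using not_less_Least[of l "\<lambda>n. t < jump_time h Y e (Suc n)"] by (simp add: L_def)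
      then show ?thesis using Suc by simp
    qed
    have "(\<Prod>i\<le>n. indicator B (Y i) :: ennreal) = 0" if "L \<le> n" for n
      using that Y by (intro prod_zero) (auto intro!: bexI[of _ L])
    then have "(\<Sum>n. ?s n) = (\<Sum>n<L. ?s n)"
      by (intro suminf_finite) auto
    also have "\<dots> \<le> ennreal (jump_time h Y e L)"
      by (rule part)
    also have "\<dots> \<le> ennreal t"
      using JL by (rule ennreal_leI)
    finally show ?thesis .
  next
    case False
    \<comment> \<open>All jump times are at most \<open>t\<close>, so the value of the path at
      \<open>t\<close> carries no information; but each partial sum is bounded by a jump time and so
      by \<open>t\<close>.\<close>
    have "(\<Sum>n<m. ?s n) \<le> ennreal t" for m
    proof -
      have "(\<Sum>n<m. ?s n) \<le> (\<Sum>n<Suc m. ?s n)"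
        by simp
      also have "\<dots> \<le> ennreal (jump_time h Y e (Suc m))"
        by (rule part)
      also have "\<dots> \<le> ennreal t"
        using False by (intro ennreal_leI) (simp add: not_less)
      finally show ?thesis .
    qed
    then show ?thesis
      by (intro suminf_le_const summableI)
  qed
qed

lemma nn_integral_exponential_density:
  "(\<integral>\<^sup>+ t. ennreal t \<partial>density lborel (\<lambda>t. ennreal (exponential_density 1 t))) = 1"
proof -
  have "(\<integral>\<^sup>+ t. ennreal t \<partial>density lborel (\<lambda>t. ennreal (exponential_density 1 t))) =
      (\<integral>\<^sup>+ t. ennreal (erlang_density 0 1 t * t ^ 1) \<partial>lborel)"
  proof (subst nn_integral_density)
    have "ennreal (exponential_density 1 t) * ennreal t = ennreal (erlang_density 0 1 t * t ^ 1)" for t :: real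
      by (cases "t < 0") (simp_all add: erlang_density_def ennreal_mult)
    then show "(\<integral>\<^sup>+ t. ennreal (exponential_density 1 t) * ennreal t \<partial>lborel) =
        (\<integral>\<^sup>+ t. ennreal (erlang_density 0 1 t * t ^ 1) \<partial>lborel)"
      by simp
  qed simp_all
  also have "\<dots> = 1"
    by (subst nn_integral_erlang_ith_moment) auto
  finally show ?thesis .
qed

lemma prob_space_exponential_clocks: "prob_space exponential_clocks"
  unfolding exponential_clocks_def
  by (intro prob_space_PiM prob_space_exponential_density) simp

lemma nn_integral_exponential_clock: "(\<integral>\<^sup>+ e. ennreal (e n) \<partial>exponential_clocks) = 1"
proof -
  let ?E = "density lborel (\<lambda>t. ennreal (exponential_density 1 t))"
  have "1 = (\<integral>\<^sup>+ t. ennreal t \<partial>distr (\<Pi>\<^sub>M i\<in>UNIV. ?E) ?E (\<lambda>e. e n))"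
    by (subst distr_PiM_component)
       (simp_all add: prob_space_exponential_density nn_integral_exponential_density)
  also have "\<dots> = (\<integral>\<^sup>+ e. ennreal (e n) \<partial>exponential_clocks)"
    unfolding exponential_clocks_def by (rule nn_integral_distr) auto
  finally show ?thesis by simp
qed

lemma AE_exponential_clocks_nonneg: "AE e in exponential_clocks. \<forall>n. 0 \<le> e n"
  unfolding exponential_clocks_def AE_all_countable
proof (intro allI AE_PiM_component)
  show "AE t in density lborel (\<lambda>t. ennreal (exponential_density 1 t)). 0 \<le> t"
    by (subst AE_density) (auto simp: exponential_density_def erlang_density_def)
qed (auto intro: prob_space_exponential_density)

text \<open>The clocks are independent of the positions and have mean 1, so integrating them out
  replaces each holding time by its mean \<open>h\<close>. The rest is the computation for the
  discrete chain with \<open>h\<close> in place of 1.\<close>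

lemma nn_integral_jump_exit_time_ge:
  fixes K :: "'a::topological_space \<Rightarrow> 'a measure"
  assumes K: "K \<in> borel \<rightarrow>\<^sub>M prob_algebra borel" and B: "B \<in> sets borel"
    and h[measurable]: "h \<in> borel_measurable borel" and h0: "\<And>z. 0 \<le> h z" and x: "x \<in> B"
  shows "(\<Sum>n. (killed K B ^^ n) (\<lambda>z. ennreal (h z)) x) \<le>
    (\<integral>\<^sup>+ \<omega>. jump_exit_time h B (fst \<omega>) (snd \<omega>) \<partial>(chain_law K x \<Otimes>\<^sub>M exponential_clocks))"
proof -
  interpret E: prob_space exponential_clocks
    by (rule prob_space_exponential_clocks)
  let ?P = "chain_law K x \<Otimes>\<^sub>M exponential_clocks"
  define F where "F n Y = (\<Prod>i\<le>n. indicator B (Y i)) * ennreal (h (Y n))" for n and Y :: "nat \<Rightarrow> 'a"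
  have F[measurable]: "F n \<in> borel_measurable (chain_law K x)" for n
    unfolding F_def
    by (intro borel_measurable_times_ennreal borel_measurable_prod_ennreal
        measurable_chain_law_component[OF K B] borel_measurable_indicator B) simp
  have e[measurable]: "(\<lambda>e. ennreal (e n)) \<in> borel_measurable exponential_clocks" for n
  proof -
    have "(\<lambda>e. e n) \<in> exponential_clocks \<rightarrow>\<^sub>M density lborel (\<lambda>t. ennreal (exponential_density 1 t))"
      unfolding exponential_clocks_def by (rule measurable_component_singleton) simp
    then have "(\<lambda>e. e n) \<in> borel_measurable exponential_clocks"
      by (subst (asm) measurable_cong_sets[OF refl, of _ borel]) auto
    then show ?thesis by simp
  qed
  have "(\<Sum>n. (killed K B ^^ n) (\<lambda>z. ennreal (h z)) x) = (\<Sum>n. \<integral>\<^sup>+ Y. F n Y \<partial>chain_law K x)"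
    unfolding F_def using nn_integral_chain_law_killed[OF K B, where f = "\<lambda>z. ennreal (h z)" and x = x] x by simp
  \<comment> \<open>The factor inserted here is the mean of the clock with index \<open>n\<close>,
    which is 1.\<close>
  also have "\<dots> = (\<Sum>n. \<integral>\<^sup>+ Y. (\<integral>\<^sup>+ e. F n Y * ennreal (e n) \<partial>exponential_clocks) \<partial>chain_law K x)"
    by (simp add: nn_integral_cmult nn_integral_exponential_clock)
  also have "\<dots> = (\<Sum>n. \<integral>\<^sup>+ \<omega>. F n (fst \<omega>) * ennreal (snd \<omega> n) \<partial>?P)"
    by (subst E.nn_integral_fst[symmetric]) simp_all
  also have "\<dots> = (\<integral>\<^sup>+ \<omega>. (\<Sum>n. F n (fst \<omega>) * ennreal (snd \<omega> n)) \<partial>?P)"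
    by (rule nn_integral_suminf[symmetric]) simp
  also have "\<dots> \<le> (\<integral>\<^sup>+ \<omega>. jump_exit_time h B (fst \<omega>) (snd \<omega>) \<partial>?P)"
  proof (rule nn_integral_mono_AE)
    \<comment> \<open>The pathwise bound requires nonnegative clocks, which holds off a null set
      \<open>N\<close> of clock sequences; the rectangle over \<open>N\<close> is null in the
      product.\<close>
    have "AE \<omega> in ?P. \<forall>n. 0 \<le> snd \<omega> n"
    proof -
      obtain N where N: "N \<in> null_sets exponential_clocks"
        "{e \<in> space exponential_clocks. \<not> (\<forall>n. 0 \<le> e n)} \<subseteq> N"
        using AE_exponential_clocks_nonneg unfolding eventually_ae_filter by blast
      have "space (chain_law K x) \<times> N \<in> null_sets ?P"
        using N(1) by (auto simp: null_sets_def E.emeasure_pair_measure_Times)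
      moreover have "{\<omega> \<in> space ?P. \<not> (\<forall>n. 0 \<le> snd \<omega> n)} \<subseteq> space (chain_law K x) \<times> N"
        using N(2) by (force simp: space_pair_measure)
      ultimately show ?thesis
        by (rule AE_I')
    qed
    then show "AE \<omega> in ?P. (\<Sum>n. F n (fst \<omega>) * ennreal (snd \<omega> n)) \<le>
        jump_exit_time h B (fst \<omega>) (snd \<omega>)"
      by eventually_elim (auto simp: F_def intro!: jump_exit_time_ge h0)
  qed
  finally show ?thesis .
qed

section \<open>Resolvent bounds from supersolutions\<close>

lemma (in finite_measure) L2_fun_integrable:
  assumes f: "f \<in> L2_fun M"
  shows "integrable M f"
proof (rule Bochner_Integration.integrable_bound)
  have [measurable]: "f \<in> borel_measurable M"
    using f by (simp add: L2_fun_def)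
  show "f \<in> borel_measurable M" by simp
  show "integrable M (\<lambda>x. 1 + (cmod (f x))\<^sup>2)"
    using f by (simp add: L2_fun_def)
  have "cmod (f x) \<le> norm (1 + (cmod (f x))\<^sup>2)" for x
    using zero_le_power2[of "cmod (f x) - 1"] norm_ge_zero[of "f x"]
      abs_ge_self[of "1 + (cmod (f x))\<^sup>2"]
    unfolding power2_diff real_norm_def one_power2 mult_1_right by linarith
  then show "AE x in M. norm (f x) \<le> norm (1 + (cmod (f x))\<^sup>2)" by simp
qed

text \<open>Cauchy-Schwarz against the constant 1, obtained by expanding the integral of the square
  of \<open>?m * cmod (f x) - ?I\<close> and dividing by the total mass \<open>?m\<close> when it is
  positive.\<close>

lemma (in finite_measure) square_integral_norm_le:
  assumes f: "f \<in> L2_fun M"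
  shows "(\<integral>x. cmod (f x) \<partial>M)\<^sup>2 \<le> measure M (space M) * (\<integral>x. (cmod (f x))\<^sup>2 \<partial>M)"
proof -
  let ?m = "measure M (space M)" and ?I = "\<integral>x. cmod (f x) \<partial>M"
  have [simp]: "integrable M (\<lambda>x. (cmod (f x))\<^sup>2)" "integrable M (\<lambda>x. cmod (f x))"
    using f L2_fun_integrable[OF f] by (auto simp: L2_fun_def)
  have "0 \<le> (\<integral>x. (?m * cmod (f x) - ?I)\<^sup>2 \<partial>M)"
    by simp
  also have "\<dots> = (\<integral>x. ?m\<^sup>2 * (cmod (f x))\<^sup>2 - 2 * ?m * ?I * cmod (f x) + ?I\<^sup>2 \<partial>M)"
    by (simp add: power2_diff power_mult_distrib mult_ac)
  also have "\<dots> = ?m\<^sup>2 * (\<integral>x. (cmod (f x))\<^sup>2 \<partial>M) - 2 * ?m * ?I * ?I + ?I\<^sup>2 * ?m"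
    by (subst Bochner_Integration.integral_add Bochner_Integration.integral_diff; simp)+
  also have "\<dots> = ?m\<^sup>2 * (\<integral>x. (cmod (f x))\<^sup>2 \<partial>M) - ?m * ?I\<^sup>2"
    by (simp add: power2_eq_square)
  finally have *: "?m * ?I\<^sup>2 \<le> ?m * (?m * (\<integral>x. (cmod (f x))\<^sup>2 \<partial>M))"
    by (simp add: power2_eq_square)
  show ?thesis
  proof (cases "?m = 0")
    case True
    then have "emeasure M (space M) = 0"
      by (simp add: emeasure_eq_measure)
    then have "?I = 0"
      by (intro integral_eq_zero_AE) (auto simp: AE_iff_null null_sets_def intro!: AE_I[of _ _ "space M"])
    then show ?thesis using True by simp
  next
    case False
    then show ?thesis
      using * by (simp add: measure_nonneg less_le)
  qed
qed

lemma L2_nrm_le: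
  assumes "(\<integral>x. (cmod (f x))\<^sup>2 \<partial>M) \<le> C * (\<integral>x. (cmod (g x))\<^sup>2 \<partial>M)"
  shows "L2_nrm M f \<le> sqrt C * L2_nrm M g"
  using assms by (simp add: L2_nrm_def real_sqrt_mult[symmetric])

text \<open>Write \<open>P\<close> for the integral operator with kernel \<open>\<kappa>\<close>,
  \<open>s = Re z\<close> and \<open>E = D - z\<close>. Then \<open>A - z = E (I - N)\<close> with
  \<open>N = (D / E) P\<close>. The hypothesis \<open>super\<close> says
  \<open>D P \<phi> \<le> (D - \<theta>) \<phi>\<close>, and \<open>cmod E \<ge> D - s\<close>, so
  \<open>N\<close> contracts the supremum norm weighted by \<open>1 / \<phi>\<close>. The bounded
  kernel sends integrable functions into that space in one step, so the Neumann series
  converges.\<close>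

lemma L2_resolvent_Neumann:
  fixes M :: "'a measure" and D \<phi> :: "'a \<Rightarrow> real" and \<kappa> :: "'a \<Rightarrow> 'a \<Rightarrow> real"
    and A :: "('a \<Rightarrow> complex) \<Rightarrow> 'a \<Rightarrow> complex"
  assumes "finite_measure M" and M: "space M \<noteq> {}"
    and \<kappa>[measurable]: "(\<lambda>(x, y). \<kappa> x y) \<in> borel_measurable (M \<Otimes>\<^sub>M M)"
    and \<kappa>0: "\<And>x y. x \<in> space M \<Longrightarrow> y \<in> space M \<Longrightarrow> 0 \<le> \<kappa> x y"
    and \<kappa>K: "\<And>x y. x \<in> space M \<Longrightarrow> y \<in> space M \<Longrightarrow> \<kappa> x y \<le> K"
    and D[measurable]: "D \<in> borel_measurable M"
    and D0: "\<And>x. x \<in> space M \<Longrightarrow> 0 \<le> D x" and DQ: "\<And>x. x \<in> space M \<Longrightarrow> D x \<le> Q"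
    and \<phi>[measurable]: "\<phi> \<in> borel_measurable M"
    and c: "0 < c" and \<phi>c: "\<And>x. x \<in> space M \<Longrightarrow> c \<le> \<phi> x"
    and \<phi>T: "\<And>x. x \<in> space M \<Longrightarrow> \<phi> x \<le> T"
    and super: "\<And>x. x \<in> space M \<Longrightarrow> D x * (\<integral>y. \<kappa> x y * \<phi> y \<partial>M) + \<theta> * \<phi> x \<le> D x * \<phi> x"
    and A: "\<And>f x. f \<in> L2_fun M \<Longrightarrow> x \<in> space M \<Longrightarrow>
      A f x = D x *\<^sub>R (f x - (\<integral>y. \<kappa> x y *\<^sub>R f y \<partial>M))"
    and z: "Re z < \<theta>"
  shows "z \<in> L2_resolvent M A"
proof -
  obtain w where w: "w \<in> space M" using M by auto
  interpret finite_measure M by fact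
  define s where "s = Re z"
  \<comment> \<open>The pointwise contraction factor is \<open>(D x - \<theta>) / (D x - s) = 1 -
    (\<theta> - s) / (D x - s)\<close>. It increases with \<open>D x\<close>, so its value at the
    upper bound \<open>Q\<close> serves for all \<open>x\<close>.\<close>
  define \<rho> where "\<rho> = 1 - (\<theta> - s) / (Q - s)"
  define E where "E x = complex_of_real (D x) - z" for x
  have \<phi>0: "0 < \<phi> x" if "x \<in> space M" for x
    using \<phi>c[OF that] c by linarith
  \<comment> \<open>Nonnegativity of \<open>\<kappa>\<close> and \<open>\<phi>\<close> lets the
    integral be dropped from \<open>super\<close>. Consequently
    \<open>Re (E x) \<ge> \<theta> - s > 0\<close>, so division by \<open>E\<close> is
    harmless.\<close>
  have D\<theta>: "\<theta> \<le> D x" if x: "x \<in> space M" for x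
  proof -
    have "0 \<le> (\<integral>y. \<kappa> x y * \<phi> y \<partial>M)"
      using \<kappa>0[OF x] \<phi>0 by (intro integral_nonneg_AE AE_I2) (simp add: less_imp_le)
    then have "0 \<le> D x * (\<integral>y. \<kappa> x y * \<phi> y \<partial>M)"
      using D0[OF x] by simp
    then have "\<theta> * \<phi> x \<le> D x * \<phi> x"
      using super[OF x] by linarith
    then show ?thesis
      using \<phi>0[OF x] by simp
  qed
  have E: "\<theta> - s \<le> cmod (E x)" "D x - s \<le> cmod (E x)" "E x \<noteq> 0" if "x \<in> space M" for x
  proof -
    have "D x - s = Re (E x)"
      by (simp add: E_def s_def)
    also have "\<dots> \<le> cmod (E x)"
      by (rule complex_Re_le_cmod)
    finally show "D x - s \<le> cmod (E x)" .
    then show "\<theta> - s \<le> cmod (E x)"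
      using D\<theta>[OF that] by linarith
    then show "E x \<noteq> 0"
      using z by (auto simp: s_def)
  qed
  have [measurable]: "E \<in> borel_measurable M"
    unfolding E_def by measurable
  have Q\<theta>: "\<theta> \<le> Q"
    using D\<theta>[OF w] DQ[OF w] by linarith
  have \<rho>0: "0 \<le> \<rho>" and \<rho>1: "\<rho> < 1"
    using Q\<theta> z by (auto simp: \<rho>_def s_def divide_simps)
  have "0 \<le> K"
    using \<kappa>0[OF w w] \<kappa>K[OF w w] by linarith
  have "0 \<le> Q"
    using D0[OF w] DQ[OF w] by linarith

  \<comment> \<open>The equation \<open>A f - z f = g\<close> becomes
    \<open>f - N f = g / E\<close>.\<close>
  define N where "N f x = of_real (D x) / E x * (\<integral>y. \<kappa> x y *\<^sub>R f y \<partial>M)" for f :: "'a \<Rightarrow> complex" and x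
  have N_meas[measurable]: "N f \<in> borel_measurable M" if [measurable]: "f \<in> borel_measurable M" for f
    unfolding N_def by measurable
  have int: "integrable M (\<lambda>y. \<kappa> x y *\<^sub>R f y)" if "integrable M f" and x: "x \<in> space M"
    for x and f :: "'a \<Rightarrow> complex"
  proof (rule Bochner_Integration.integrable_bound)
    have [measurable]: "f \<in> borel_measurable M"
      using that by simp
    show "integrable M (\<lambda>y. K *\<^sub>R f y)"
      using that by simp
    have "(\<lambda>y. \<kappa> x y) \<in> borel_measurable M"
      using measurable_compose[OF measurable_Pair1'[OF x] \<kappa>] by simp
    then show "(\<lambda>y. \<kappa> x y *\<^sub>R f y) \<in> borel_measurable M"
      by measurable
    show "AE y in M. norm (\<kappa> x y *\<^sub>R f y) \<le> norm (K *\<^sub>R f y)"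
      using \<kappa>0[OF x] \<kappa>K[OF x] \<open>0 \<le> K\<close> by (intro AE_I2) (auto intro!: mult_right_mono)
  qed
  have N_diff: "N (\<lambda>y. f y - g y) x = N f x - N g x"
    if "integrable M f" "integrable M g" "x \<in> space M" for f g x
    using int[OF that(1,3)] int[OF that(2,3)] by (simp add: N_def scaleR_diff_right algebra_simps)
  \<comment> \<open>The kernel is at most \<open>K\<close>, \<open>D\<close> is at most
    \<open>Q\<close> and \<open>cmod (E x)\<close> at least \<open>\<theta> - s\<close>; so
    \<open>N\<close> maps integrable functions to bounded ones.\<close>
  have N_smooth: "cmod (N f x) \<le> Q / (\<theta> - s) * K * (\<integral>y. cmod (f y) \<partial>M)"
    if f: "integrable M f" and x: "x \<in> space M" for f x
  proof -
    have "cmod (\<integral>y. \<kappa> x y *\<^sub>R f y \<partial>M) \<le> (\<integral>y. cmod (\<kappa> x y *\<^sub>R f y) \<partial>M)"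
      by (rule integral_norm_bound)
    also have "\<dots> \<le> (\<integral>y. K * cmod (f y) \<partial>M)"
      using int[OF f x] f \<kappa>0[OF x] \<kappa>K[OF x]
      by (intro integral_mono integrable_norm) (auto intro!: mult_right_mono)
    finally have 1: "cmod (\<integral>y. \<kappa> x y *\<^sub>R f y \<partial>M) \<le> K * (\<integral>y. cmod (f y) \<partial>M)"
      by simp
    have "D x / cmod (E x) \<le> Q / (\<theta> - s)"
      using D0[OF x] DQ[OF x] E[OF x] z by (intro frac_le) (auto simp: s_def)
    with 1 show ?thesis
      using D0[OF x] \<open>0 \<le> Q\<close> z unfolding N_def norm_mult norm_divide mult.assoc
      by (intro mult_mono) (auto simp: s_def)
  qed

  have N_contract: "cmod (N f x) \<le> \<rho> * a * \<phi> x"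
    if f: "f \<in> borel_measurable M" "\<And>y. y \<in> space M \<Longrightarrow> cmod (f y) \<le> a * \<phi> y" and x: "x \<in> space M" for f a x
  proof -
    have a: "0 \<le> a"
      using f(2)[OF x] \<phi>0[OF x] norm_ge_zero[of "f x"] by (smt (verit) mult_neg_pos)
    have int_\<phi>: "integrable M \<phi>"
      using \<phi>T \<phi>0 by (intro integrable_const_bound[of _ T]) (auto simp: less_imp_le)
    have int_f: "integrable M f"
      using f \<phi>0 a by (intro Bochner_Integration.integrable_bound[OF integrable_mult_right[OF int_\<phi>, of a]])
        (auto simp: abs_mult abs_of_pos)
    have int_\<kappa>: "integrable M (\<lambda>y. \<kappa> x y * \<phi> y)"
      using int[OF _ x, of "\<lambda>y. complex_of_real (\<phi> y)"] int_\<phi>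
      by (simp add: scaleR_conv_of_real complex_of_real_integrable_eq del: of_real_mult flip: of_real_mult)
    let ?I = "\<integral>y. \<kappa> x y * \<phi> y \<partial>M"
    have "cmod (\<integral>y. \<kappa> x y *\<^sub>R f y \<partial>M) \<le> (\<integral>y. cmod (\<kappa> x y *\<^sub>R f y) \<partial>M)"
      by (rule integral_norm_bound)
    also have "\<dots> \<le> (\<integral>y. a * (\<kappa> x y * \<phi> y) \<partial>M)"
    proof (intro integral_mono integrable_norm int int_f x integrable_mult_right int_\<kappa>)
      fix y assume y: "y \<in> space M"
      show "cmod (\<kappa> x y *\<^sub>R f y) \<le> a * (\<kappa> x y * \<phi> y)"
        using mult_left_mono[OF f(2)[OF y] \<kappa>0[OF x y]] \<kappa>0[OF x y] by (simp add: mult_ac)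
    qed
    finally have 1: "cmod (\<integral>y. \<kappa> x y *\<^sub>R f y \<partial>M) \<le> a * ?I"
      by simp
    have pos: "0 < D x - s"
      using D\<theta>[OF x] z by (simp add: s_def)
    have "cmod (N f x) = D x * cmod (\<integral>y. \<kappa> x y *\<^sub>R f y \<partial>M) / cmod (E x)"
      using D0[OF x] by (simp add: N_def norm_mult norm_divide)
    also have "\<dots> \<le> D x * (a * ?I) / (D x - s)"
      using 1 order_trans[OF norm_ge_zero 1] D0[OF x] E(2)[OF x] pos
      by (intro frac_le mult_left_mono mult_nonneg_nonneg[of "D x"]) auto
    also have "\<dots> = a * (D x * ?I) / (D x - s)"
      by simp
    also have "\<dots> \<le> a * ((D x - \<theta>) * \<phi> x) / (D x - s)"
      using super[OF x] a pos by (intro divide_right_mono mult_left_mono) (auto simp: algebra_simps)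
    also have "\<dots> = (1 - (\<theta> - s) / (D x - s)) * (a * \<phi> x)"
      using pos by (simp add: field_simps)
    also have "\<dots> \<le> \<rho> * (a * \<phi> x)"
      unfolding \<rho>_def using a \<phi>0[OF x] DQ[OF x] pos z
      by (intro mult_right_mono diff_left_mono divide_left_mono) (auto simp: s_def)
    finally show ?thesis by (simp add: mult.assoc)
  qed

  \<comment> \<open>Dividing by the lower bound \<open>c\<close> of \<open>\<phi>\<close> turns the
    uniform bound on \<open>N f\<close> into the weighted bound
    \<open>b f * \<phi> x\<close>.\<close>
  define b where "b f = Q / (\<theta> - s) * K * (\<integral>y. cmod (f y) \<partial>M) / c" for f :: "'a \<Rightarrow> complex"
  have b0: "0 \<le> b f" for f
    using \<open>0 \<le> Q\<close> \<open>0 \<le> K\<close> z c by (simp add: b_def s_def)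
  have iter_meas: "(N ^^ n) f \<in> borel_measurable M" if "f \<in> borel_measurable M" for f n
    using that by (induction n) auto
  \<comment> \<open>The first application of \<open>N\<close> is spent on passing from integrable to
    bounded, so \<open>Suc n\<close> applications give \<open>n\<close> factors
    \<open>\<rho>\<close>.\<close>
  have iter: "cmod ((N ^^ Suc n) f x) \<le> \<rho> ^ n * b f * \<phi> x"
    if f: "integrable M f" and "x \<in> space M" for f x n
    using that(2)
  proof (induction n arbitrary: x)
    case 0
    have "cmod (N f x) \<le> b f * c"
      using N_smooth[OF f 0] c by (simp add: b_def)
    also have "\<dots> \<le> b f * \<phi> x"
      using \<phi>c[OF 0] b0 by (rule mult_left_mono)
    finally show ?case by simp
  next
    case (Suc n)
    have "cmod (N ((N ^^ Suc n) f) x) \<le> \<rho> * (\<rho> ^ n * b f) * \<phi> x"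
      using Suc f by (intro N_contract iter_meas) auto
    then show ?case by (simp add: mult_ac)
  qed
  have int_bounded: "integrable M f" if "f \<in> borel_measurable M" "\<And>x. x \<in> space M \<Longrightarrow> cmod (f x) \<le> a" for f a
    using that by (intro integrable_const_bound[of _ a]) auto
  have iter_int: "integrable M ((N ^^ n) f)" if f: "integrable M f" for f n
  proof (cases n)
    case (Suc m)
    show ?thesis
    proof (rule int_bounded[of _ "\<rho> ^ m * b f * T"])
      show "cmod ((N ^^ n) f x) \<le> \<rho> ^ m * b f * T" if x: "x \<in> space M" for x
      proof -
        have "cmod ((N ^^ n) f x) \<le> \<rho> ^ m * b f * \<phi> x"
          using iter[OF f x, of m] Suc by simp
        also have "\<dots> \<le> \<rho> ^ m * b f * T"
          using \<phi>T[OF x] b0 \<rho>0 by (intro mult_left_mono) auto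
        finally show ?thesis .
      qed
    qed (use f in \<open>auto intro!: iter_meas\<close>)
  qed (use f in simp)
  have summ: "summable (\<lambda>n. norm ((N ^^ n) f x))" if "integrable M f" "x \<in> space M" for f x
  proof -
    have "summable (\<lambda>n. \<rho> ^ n * (b f * \<phi> x))"
      using \<rho>0 \<rho>1 by (intro summable_mult2 summable_geometric) auto
    then have "summable (\<lambda>n. norm ((N ^^ Suc n) f x))"
      by (rule summable_comparison_test'[where N = 0]) (use iter[OF that] in \<open>simp add: mult.assoc\<close>)
    then show ?thesis
      by (subst (asm) summable_Suc_iff)
  qed

  define h where "h g y = g y / E y" for g and y :: 'a
  \<comment> \<open>The Neumann series is summed pointwise. Term \<open>0\<close> is merely in
    \<open>L2_fun M\<close>; all later terms are bounded and decay geometrically.\<close>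
  define S where "S g x = (\<Sum>n. (N ^^ n) (h g) x)" for g x
  \<comment> \<open>Chosen so that the series without term \<open>0\<close> is at most
    \<open>q\<close> times the integral of \<open>cmod (h g x)\<close>.\<close>
  define q where "q = T / (1 - \<rho>) * (Q / (\<theta> - s) * K / c)"
  have h_L2: "h g \<in> L2_fun M" and
    h_nrm: "(\<integral>x. (cmod (h g x))\<^sup>2 \<partial>M) \<le> 1 / (\<theta> - s)\<^sup>2 * (\<integral>x. (cmod (g x))\<^sup>2 \<partial>M)"
    if g: "g \<in> L2_fun M" for g
  proof -
    have [measurable]: "g \<in> borel_measurable M" and int_g: "integrable M (\<lambda>x. (cmod (g x))\<^sup>2)"
      using g by (auto simp: L2_fun_def)
    have h_meas: "h g \<in> borel_measurable M"
      unfolding h_def by measurable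
    have le: "(cmod (h g x))\<^sup>2 \<le> 1 / (\<theta> - s)\<^sup>2 * (cmod (g x))\<^sup>2" if x: "x \<in> space M" for x
    proof -
      have "cmod (h g x) \<le> cmod (g x) / (\<theta> - s)"
        unfolding h_def norm_divide using E[OF x] z by (intro divide_left_mono) (auto simp: s_def)
      then have "(cmod (h g x))\<^sup>2 \<le> (cmod (g x) / (\<theta> - s))\<^sup>2"
        by (intro power_mono) auto
      then show ?thesis by (simp add: power_divide)
    qed
    have int_h: "integrable M (\<lambda>x. (cmod (h g x))\<^sup>2)"
      by (rule Bochner_Integration.integrable_bound[OF integrable_mult_right[OF int_g, of "1 / (\<theta> - s)\<^sup>2"]])
        (use h_meas le in auto)
    then show "h g \<in> L2_fun M"
      using h_meas by (simp add: L2_fun_def)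
    have "(\<integral>x. (cmod (h g x))\<^sup>2 \<partial>M) \<le> (\<integral>x. 1 / (\<theta> - s)\<^sup>2 * (cmod (g x))\<^sup>2 \<partial>M)"
      by (rule integral_mono[OF int_h integrable_mult_right[OF int_g] le])
    then show "(\<integral>x. (cmod (h g x))\<^sup>2 \<partial>M) \<le> 1 / (\<theta> - s)\<^sup>2 * (\<integral>x. (cmod (g x))\<^sup>2 \<partial>M)"
      by simp
  qed
  have S_split: "S g x = h g x + (\<Sum>n. (N ^^ Suc n) (h g) x)"
    if "integrable M (h g)" "x \<in> space M" for g x
    unfolding S_def using suminf_split_head[OF summable_norm_cancel[OF summ[OF that]]] by simp
  have tail: "cmod (\<Sum>n. (N ^^ Suc n) f x) \<le> T / (1 - \<rho>) * b f" if f: "integrable M f" and x: "x \<in> space M" for f x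
  proof -
    have gs: "(\<lambda>n. \<rho> ^ n * (b f * \<phi> x)) sums (1 / (1 - \<rho>) * (b f * \<phi> x))"
      using \<rho>0 \<rho>1 by (intro sums_mult2 geometric_sums) auto
    have s1: "summable (\<lambda>n. norm ((N ^^ Suc n) f x))"
      using summ[OF f x] by (subst summable_Suc_iff)
    have "cmod (\<Sum>n. (N ^^ Suc n) f x) \<le> (\<Sum>n. norm ((N ^^ Suc n) f x))"
      by (rule summable_norm[OF s1])
    also have "\<dots> \<le> (\<Sum>n. \<rho> ^ n * (b f * \<phi> x))"
      using iter[OF f x] by (intro suminf_le s1 sums_summable[OF gs]) (simp add: mult.assoc)
    also have "\<dots> = 1 / (1 - \<rho>) * (b f * \<phi> x)"
      using gs by (rule sums_unique[symmetric])
    also have "\<dots> \<le> 1 / (1 - \<rho>) * (b f * T)"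
      using \<phi>T[OF x] b0 \<rho>1 by (intro mult_left_mono) auto
    finally show ?thesis by (simp add: mult_ac)
  qed
  have N_S: "N (S g) x = (\<Sum>n. (N ^^ Suc n) (h g) x)" if g: "integrable M (h g)" and x: "x \<in> space M" for g x
  proof -
    let ?f = "h g"
    have int_n: "integrable M (\<lambda>y. \<kappa> x y *\<^sub>R (N ^^ n) ?f y)" for n
      by (rule int[OF iter_int[OF g] x])
    have sums_n: "summable (\<lambda>n. \<integral>y. norm (\<kappa> x y *\<^sub>R (N ^^ n) ?f y) \<partial>M)"
    \<comment> \<open>The geometric bound is available from the first iterate on, so the comparison
      is made for the shifted series.\<close>
    proof (subst summable_Suc_iff[symmetric], rule summable_comparison_test'[where N = 0])
      show "summable (\<lambda>n. \<rho> ^ n * (measure M (space M) * (K * (b ?f * T))))"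
        using \<rho>0 \<rho>1 by (intro summable_mult2 summable_geometric) auto
      show "norm (\<integral>y. norm (\<kappa> x y *\<^sub>R (N ^^ Suc n) ?f y) \<partial>M) \<le>
          \<rho> ^ n * (measure M (space M) * (K * (b ?f * T)))" for n
      proof -
        have "(\<integral>y. norm (\<kappa> x y *\<^sub>R (N ^^ Suc n) ?f y) \<partial>M) \<le> (\<integral>y. K * (\<rho> ^ n * b ?f * T) \<partial>M)"
        proof (intro integral_mono integrable_norm int_n)
          fix y assume y: "y \<in> space M"
          have "norm ((N ^^ Suc n) ?f y) \<le> \<rho> ^ n * b ?f * T"
            using iter[OF g y, of n] \<phi>T[OF y] b0[of ?f] \<rho>0
            by (meson order_trans mult_left_mono mult_nonneg_nonneg zero_le_power)
          then show "norm (\<kappa> x y *\<^sub>R (N ^^ Suc n) ?f y) \<le> K * (\<rho> ^ n * b ?f * T)"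
            unfolding norm_scaleR using \<kappa>0[OF x y] \<kappa>K[OF x y] \<open>0 \<le> K\<close> by (intro mult_mono) auto
        qed simp
        then show ?thesis by (simp add: mult_ac)
      qed
    qed
    have ae: "AE y in M. summable (\<lambda>n. norm (\<kappa> x y *\<^sub>R (N ^^ n) ?f y))"
      using summ[OF g] by (intro AE_I2) (auto intro: summable_mult)
    have "(\<integral>y. \<kappa> x y *\<^sub>R S g y \<partial>M) = (\<integral>y. (\<Sum>n. \<kappa> x y *\<^sub>R (N ^^ n) ?f y) \<partial>M)"
      unfolding S_def using summable_norm_cancel[OF summ[OF g]]
      by (intro Bochner_Integration.integral_cong) (auto simp: suminf_scaleR_right)
    also have "\<dots> = (\<Sum>n. \<integral>y. \<kappa> x y *\<^sub>R (N ^^ n) ?f y \<partial>M)"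
      by (rule integral_suminf[OF int_n ae sums_n])
    finally have *: "(\<integral>y. \<kappa> x y *\<^sub>R S g y \<partial>M) = (\<Sum>n. \<integral>y. \<kappa> x y *\<^sub>R (N ^^ n) ?f y \<partial>M)" .
    have "summable (\<lambda>n. \<integral>y. \<kappa> x y *\<^sub>R (N ^^ n) ?f y \<partial>M)"
      by (rule summable_integral[OF int_n ae sums_n])
    then show ?thesis
      unfolding N_def[of "S g"] * by (simp only: suminf_mult[symmetric] funpow.simps o_apply N_def[of "(N ^^ n) (h g)" for n])
  qed
  have S_L2: "S g \<in> L2_fun M" and
    S_nrm: "(\<integral>x. (cmod (S g x))\<^sup>2 \<partial>M) \<le>
      (2 + 2 * q\<^sup>2 * (measure M (space M))\<^sup>2) / (\<theta> - s)\<^sup>2 * (\<integral>x. (cmod (g x))\<^sup>2 \<partial>M)"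
    if g: "g \<in> L2_fun M" for g
  proof -
    let ?m = "measure M (space M)" and ?I = "\<integral>x. cmod (h g x) \<partial>M" and ?J = "\<integral>x. (cmod (h g x))\<^sup>2 \<partial>M"
    have int_h: "integrable M (h g)" and int_h2: "integrable M (\<lambda>x. (cmod (h g x))\<^sup>2)"
      using h_L2[OF g] L2_fun_integrable[OF h_L2[OF g]] by (simp_all add: L2_fun_def)
    have [measurable]: "(N ^^ n) (h g) \<in> borel_measurable M" for n
      using int_h by (intro iter_meas) simp
    have S_meas: "S g \<in> borel_measurable M"
      unfolding S_def by measurable
    have le: "(cmod (S g x))\<^sup>2 \<le> 2 * (cmod (h g x))\<^sup>2 + 2 * q\<^sup>2 * ?I\<^sup>2" if x: "x \<in> space M" for x
    proof -
      have "cmod (S g x) \<le> cmod (h g x) + q * ?I"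
        unfolding S_split[OF int_h x] using tail[OF int_h x]
        by (intro order_trans[OF norm_triangle_ineq] add_left_mono) (simp add: q_def b_def mult_ac)
      then have "(cmod (S g x))\<^sup>2 \<le> (cmod (h g x) + q * ?I)\<^sup>2"
        by (intro power_mono) auto
      \<comment> \<open>Adding the square of the difference gives
        \<open>(u + v)\<^sup>2 \<le> 2 * u\<^sup>2 + 2 * v\<^sup>2\<close>. The integral
        \<open>?I\<close> is then controlled by \<open>?J\<close> through Cauchy-Schwarz.\<close>
      also have "\<dots> \<le> (cmod (h g x) + q * ?I)\<^sup>2 + (cmod (h g x) - q * ?I)\<^sup>2"
        by simp
      also have "\<dots> = 2 * (cmod (h g x))\<^sup>2 + 2 * q\<^sup>2 * ?I\<^sup>2"
        by (simp add: power2_sum power2_diff power_mult_distrib)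
      finally show ?thesis .
    qed
    have int_rhs: "integrable M (\<lambda>x. 2 * (cmod (h g x))\<^sup>2 + 2 * q\<^sup>2 * ?I\<^sup>2)"
      using int_h2 by simp
    have int_S: "integrable M (\<lambda>x. (cmod (S g x))\<^sup>2)"
      by (rule Bochner_Integration.integrable_bound[OF int_rhs]) (use S_meas le in auto)
    then show "S g \<in> L2_fun M"
      using S_meas by (simp add: L2_fun_def)
    have "(\<integral>x. (cmod (S g x))\<^sup>2 \<partial>M) \<le> (\<integral>x. 2 * (cmod (h g x))\<^sup>2 + 2 * q\<^sup>2 * ?I\<^sup>2 \<partial>M)"
      by (rule integral_mono[OF int_S int_rhs le])
    also have "\<dots> = 2 * ?J + 2 * q\<^sup>2 * ?m * ?I\<^sup>2"
      using int_h2 by simp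
    also have "\<dots> \<le> 2 * ?J + 2 * q\<^sup>2 * ?m * (?m * ?J)"
      using square_integral_norm_le[OF h_L2[OF g]] by (intro add_left_mono mult_left_mono) auto
    also have "\<dots> = (2 + 2 * q\<^sup>2 * ?m\<^sup>2) * ?J"
      by (simp add: power2_eq_square algebra_simps)
    also have "\<dots> \<le> (2 + 2 * q\<^sup>2 * ?m\<^sup>2) * (1 / (\<theta> - s)\<^sup>2 * (\<integral>x. (cmod (g x))\<^sup>2 \<partial>M))"
      by (intro mult_left_mono h_nrm[OF g]) auto
    finally show "(\<integral>x. (cmod (S g x))\<^sup>2 \<partial>M) \<le>
      (2 + 2 * q\<^sup>2 * ?m\<^sup>2) / (\<theta> - s)\<^sup>2 * (\<integral>x. (cmod (g x))\<^sup>2 \<partial>M)"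
      by simp
  qed
  have A_E: "A f x - z * f x = E x * (f x - N f x)" if "f \<in> L2_fun M" "x \<in> space M" for f x
  proof -
    have "E x * (f x - N f x) = E x * f x - of_real (D x) * (\<integral>y. \<kappa> x y *\<^sub>R f y \<partial>M)"
      using E(3)[OF that(2)] by (simp add: N_def right_diff_distrib)
    then show ?thesis
      unfolding A[OF that] E_def scaleR_conv_of_real[of "D x"] by (simp add: algebra_simps)
  qed
  have right: "A (S g) x - z * S g x = g x" if g: "g \<in> L2_fun M" and x: "x \<in> space M" for g x
  proof -
    have int_h: "integrable M (h g)"
      using h_L2[OF g] by (rule L2_fun_integrable)
    have "S g x - N (S g) x = h g x"
      unfolding N_S[OF int_h x] S_split[OF int_h x] by simp
    then show ?thesis
      using E(3)[OF x] unfolding A_E[OF S_L2[OF g] x] by (simp add: h_def)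
  qed
  have left: "S (\<lambda>y. A f y - z * f y) x = f x" if f: "f \<in> L2_fun M" and x: "x \<in> space M" for f x
  proof -
    let ?g = "\<lambda>y. A f y - z * f y"
    have int_f: "integrable M f"
      using f by (rule L2_fun_integrable)
    \<comment> \<open>Since \<open>h ?g = f - N f\<close> on the space, the series telescopes, and
      its limit is \<open>f x\<close> because the iterates of \<open>N\<close> on \<open>f\<close>
      tend to 0.\<close>
    have "(N ^^ n) (h ?g) y = (N ^^ n) f y - (N ^^ Suc n) f y" if "y \<in> space M" for n y
      using that
    proof (induction n arbitrary: y)
      case 0
      then show ?case
        using E(3)[OF 0] by (simp add: h_def A_E[OF f 0])
    next
      case (Suc n)
      have "N ((N ^^ n) (h ?g)) y = N (\<lambda>y. (N ^^ n) f y - (N ^^ Suc n) f y) y"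
        unfolding N_def[of "(N ^^ n) (h ?g)"] N_def[of "\<lambda>y. (N ^^ n) f y - (N ^^ Suc n) f y"]
        using Suc.IH by (simp cong: Bochner_Integration.integral_cong)
      also have "\<dots> = N ((N ^^ n) f) y - N ((N ^^ Suc n) f) y"
        by (rule N_diff[OF iter_int[OF int_f] iter_int[OF int_f] Suc.prems])
      finally show ?case by simp
    qed
    then have "S ?g x = (\<Sum>n. (N ^^ n) f x - (N ^^ Suc n) f x)"
      using x by (simp add: S_def)
    also have "\<dots> = (N ^^ 0) f x - 0"
      by (intro sums_unique[symmetric] telescope_sums' summable_LIMSEQ_zero
          summable_norm_cancel[OF summ[OF int_f x]])
    finally show ?thesis by simp
  qed
  show ?thesis
    unfolding L2_resolvent_def mem_Collect_eq
    by (rule exI[of _ S], rule exI[of _ "sqrt ((2 + 2 * q\<^sup>2 * (measure M (space M))\<^sup>2) / (\<theta> - s)\<^sup>2)"])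
      (intro conjI ballI S_L2 L2_nrm_le S_nrm AE_I2 right left)
qed

section \<open>Walks on a compact space\<close>

text \<open>The type carries no second countability class, so openness alone does not put the set
  into the product sigma-algebra. Compactness supplies a countable dense set of centres
  \<open>d\<close>, and the set is the countable union of the rectangles
  \<open>ball d q \<times> ball d (r - q)\<close> with \<open>q\<close> rational.\<close>

lemma measurable_dist_less:
  assumes "compact (UNIV :: 'a::metric_space set)"
  shows "{p :: 'a \<times> 'a. dist (fst p) (snd p) < r} \<in> sets (borel \<Otimes>\<^sub>M borel)"
proof -
  have "\<exists>k. finite k \<and> UNIV \<subseteq> (\<Union>x\<in>k. ball (x :: 'a) (1 / real (Suc n)))" for n
    using assms unfolding compact_eq_totally_bounded by simp
  then obtain k where k: "\<And>n. finite (k n)" "\<And>n. UNIV \<subseteq> (\<Union>x\<in>k n. ball (x :: 'a) (1 / real (Suc n)))"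
    by metis
  have cover: "\<exists>d\<in>(\<Union>n. k n). dist x d < e" if e: "0 < e" for x e
  proof -
    obtain n where "1 / real (Suc n) < e"
      by (rule nat_approx_posE[OF e])
    moreover obtain d where "d \<in> k n" "x \<in> ball d (1 / real (Suc n))"
      using k(2)[of n] by blast
    ultimately show ?thesis
      by (intro bexI[of _ d]) (auto simp: dist_commute)
  qed
  have "{p :: 'a \<times> 'a. dist (fst p) (snd p) < r} =
      (\<Union>d\<in>(\<Union>n. k n). \<Union>q\<in>\<rat>. ball d q \<times> ball d (r - q))"
  proof (intro set_eqI iffI)
    fix p :: "'a \<times> 'a" assume "p \<in> {p. dist (fst p) (snd p) < r}"
    then have p: "dist (fst p) (snd p) < r" by simp
    \<comment> \<open>Half the slack: with \<open>d\<close> within \<open>q < e\<close> of the first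
      point, the second point is at distance less than \<open>r - 2 * e + e = r - e < r - q\<close>
      from \<open>d\<close>.\<close>
    define e where "e = (r - dist (fst p) (snd p)) / 2"
    have "0 < e" using p by (simp add: e_def)
    from cover[OF this, of "fst p"] obtain d where d: "d \<in> (\<Union>n. k n)" "dist (fst p) d < e" by blast
    obtain q where q: "q \<in> \<rat>" "dist (fst p) d < q" "q < e"
      using Rats_dense_in_real[OF d(2)] by blast
    have "dist (snd p) d \<le> dist (fst p) (snd p) + dist (fst p) d"
      using dist_triangle[of "snd p" d "fst p"] by (simp add: dist_commute)
    also have "\<dots> < r - q"
      using d(2) q(3) by (simp add: e_def field_simps)
    finally have "p \<in> ball d q \<times> ball d (r - q)"
      using q(2) by (cases p) (simp add: dist_commute)
    then show "p \<in> (\<Union>d\<in>(\<Union>n. k n). \<Union>q\<in>\<rat>. ball d q \<times> ball d (r - q))"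
      using d(1) q(1) by blast
  next
    fix p :: "'a \<times> 'a" assume "p \<in> (\<Union>d\<in>(\<Union>n. k n). \<Union>q\<in>\<rat>. ball d q \<times> ball d (r - q))"
    then obtain d q where "dist d (fst p) < q" "dist d (snd p) < r - q" by auto
    then show "p \<in> {p. dist (fst p) (snd p) < r}"
      using dist_triangle[of "fst p" "snd p" d] by (simp add: dist_commute)
  qed
  also have "\<dots> \<in> sets (borel \<Otimes>\<^sub>M borel)"
    by (intro sets.countable_UN'' countable_UN countable_rat countable_finite[OF k(1)] pair_measureI) auto
  finally show ?thesis .
qed

text \<open>If \<open>y\<close> is within \<open>R / 2\<close> of \<open>x\<close>, then
  \<open>cball y (R / 2)\<close> lies in \<open>cball x R\<close>, so monotonicity of
  \<open>F\<close> makes the strict sublevel sets open.\<close>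

lemma upper_semicontinuous_borel_measurable:
  fixes F :: "'a::metric_space set \<Rightarrow> ennreal"
  assumes F: "\<And>A B. A \<subseteq> B \<Longrightarrow> F A \<le> F B"
  shows "(\<lambda>x. INF R\<in>{0<..}. F (cball x R)) \<in> borel_measurable borel"
proof (rule borel_measurableI_less)
  fix a :: ennreal
  have "open {x. (INF R\<in>{0<..}. F (cball x R)) < a}"
  proof (rule openI)
    fix x assume "x \<in> {x. (INF R\<in>{0<..}. F (cball x R)) < a}"
    then obtain R where R: "0 < R" "F (cball x R) < a"
      by (auto simp: INF_less_iff)
    have "(INF R\<in>{0<..}. F (cball y R)) < a" if "y \<in> ball x (R / 2)" for y
    proof -
      have "cball y (R / 2) \<subseteq> cball x R"
      proof
        fix w assume "w \<in> cball y (R / 2)"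
        then show "w \<in> cball x R"
          using that dist_triangle[of x w y] by simp
      qed
      then have "F (cball y (R / 2)) < a"
        using F R(2) by (blast intro: le_less_trans)
      then show ?thesis
        using R(1) by (auto simp: INF_less_iff intro!: bexI[of _ "R / 2"])
    qed
    then show "\<exists>e>0. ball x e \<subseteq> {x. (INF R\<in>{0<..}. F (cball x R)) < a}"
      using R(1) by (intro exI[of _ "R / 2"]) auto
  qed
  then show "{x \<in> space borel. (INF R\<in>{0<..}. F (cball x R)) < a} \<in> sets borel"
    by simp
qed

lemma max_mean_exit_mono:
  assumes "A \<subseteq> B"
  shows "max_mean_exit \<mu> r A \<le> max_mean_exit \<mu> r B"
  unfolding max_mean_exit_def mean_exit_def chain_exit_time_def
  using assms by (intro SUP_mono' SUP_subset_mono nn_integral_mono INF_superset_mono) auto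

lemma time_exponent_set_mono:
  assumes "A \<subseteq> B"
  shows "time_exponent_set \<mu> A \<le> time_exponent_set \<mu> B"
proof -
  have "T_exp \<mu> \<gamma> A \<le> T_exp \<mu> \<gamma> B" for \<gamma>
    unfolding T_exp_def
    by (intro Limsup_mono always_eventually allI mult_right_mono max_mean_exit_mono assms) simp
  then have "T_exp \<mu> \<gamma> A = \<infinity> \<Longrightarrow> T_exp \<mu> \<gamma> B = \<infinity>" for \<gamma>
    by (metis infinity_ennreal_def top.extremum_unique)
  then show ?thesis
    unfolding time_exponent_set_def by (intro SUP_subset_mono) auto
qed

lemma measurable_beta [measurable]: "beta \<mu> \<in> borel_measurable borel"
  unfolding beta_def[abs_def] time_exponent_def
  by (intro borel_measurable_enn2real upper_semicontinuous_borel_measurable time_exponent_set_mono)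

section \<open>Volumes of balls under a measure of full support\<close>

locale compact_full_support = finite_measure \<mu>
  for \<mu> :: "'a::metric_space measure" +
  assumes compact_space: "compact (UNIV :: 'a set)"
    and sets_borel [measurable_cong]: "sets \<mu> = sets borel"
    and full_support: "0 < r \<Longrightarrow> 0 < emeasure \<mu> (ball x r)"
begin

lemma space_UNIV [simp]: "space \<mu> = UNIV"
  using sets_eq_imp_space_eq[OF sets_borel] by simp

lemma measurable_\<mu>_iff: "f \<in> measurable \<mu> N \<longleftrightarrow> f \<in> measurable borel N"
  by (simp add: measurable_cong_sets[OF sets_borel refl])

lemma measurable_ball_indicator [measurable]:
  "(\<lambda>p :: 'a \<times> 'a. indicator (ball (fst p) r) (snd p) :: real) \<in> borel_measurable (borel \<Otimes>\<^sub>M borel)"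
proof -
  have eq: "(\<lambda>p. indicator (ball (fst p) r) (snd p) :: real) =
      indicator {p :: 'a \<times> 'a. dist (fst p) (snd p) < r}"
    by (auto simp: fun_eq_iff split: split_indicator)
  show ?thesis
    unfolding eq by (rule borel_measurable_indicator[OF measurable_dist_less[OF compact_space]])
qed

lemma measurable_vol [measurable]: "vol \<mu> r \<in> borel_measurable borel"
proof -
  have "(\<lambda>x. \<integral>y. (indicator (ball x r) y :: real) \<partial>\<mu>) \<in> borel_measurable borel"
    by (rule borel_measurable_lebesgue_integral) (simp add: case_prod_beta' cong: measurable_cong_sets)
  then show ?thesis
    unfolding vol_def[abs_def] by (simp add: Int_absorb2)
qed

lemma vol_pos: "0 < r \<Longrightarrow> 0 < vol \<mu> r x"
  using full_support[of r x] by (simp add: vol_def emeasure_eq_measure)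

lemma vol_le: "vol \<mu> r x \<le> measure \<mu> UNIV"
  unfolding vol_def using bounded_measure[of "ball x r"] by simp

text \<open>Finitely many balls of radius \<open>r / 2\<close> cover the space, and every ball of
  radius \<open>r\<close> contains one of them. For fixed \<open>r\<close> this is the source of the
  bound on the transition kernel.\<close>

lemma vol_lower_bound:
  assumes r: "0 < r"
  shows "\<exists>v>0. \<forall>x. v \<le> vol \<mu> r x"
proof -
  obtain k where k: "finite k" "UNIV \<subseteq> (\<Union>x\<in>k. ball (x :: 'a) (r / 2))"
    using compact_space r unfolding compact_eq_totally_bounded by (meson half_gt_zero)
  then have "k \<noteq> {}" by auto
  define v where "v = Min ((\<lambda>x. vol \<mu> (r / 2) x) ` k)"
  have "0 < v"
    using k(1) \<open>k \<noteq> {}\<close> vol_pos[of "r / 2"] r by (simp add: v_def)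
  moreover have "v \<le> vol \<mu> r x" for x
  proof -
    obtain d where d: "d \<in> k" "dist d x < r / 2"
      using subsetD[OF k(2) UNIV_I, of x] by auto
    have "ball d (r / 2) \<subseteq> ball x r"
    proof
      fix w assume "w \<in> ball d (r / 2)"
      then show "w \<in> ball x r"
        using d(2) dist_triangle[of x w d] by (simp add: dist_commute)
    qed
    then have "vol \<mu> (r / 2) d \<le> vol \<mu> r x"
      unfolding vol_def by (intro finite_measure_mono) (auto simp: sets_borel)
    moreover have "v \<le> vol \<mu> (r / 2) d"
      unfolding v_def using k(1) d(1) by simp
    ultimately show ?thesis by simp
  qed
  ultimately show ?thesis by blast
qed

end

text \<open>The walks of the theorem are the cases \<open>\<tau> = 1\<close> and \<open>\<tau> x = r powr beta \<mu> x\<close>.\<close>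

locale ball_walk = compact_full_support \<mu>
  for \<mu> :: "'a::metric_space measure" +
  fixes r :: real and \<tau> :: "'a \<Rightarrow> real" and m :: "'a \<Rightarrow> real" and t0 t1 :: real
  assumes r_pos: "0 < r" and t0: "0 < t0" and \<tau>_ge: "t0 \<le> \<tau> x" and \<tau>_le: "\<tau> x \<le> t1"
    and \<tau>_meas [measurable]: "\<tau> \<in> borel_measurable borel"
    and m_eq: "m x = vol \<mu> r x * \<tau> x"
begin

section \<open>Normalisation and bounds of the ball kernel\<close>

lemma m_meas [measurable]: "m \<in> borel_measurable borel"
  unfolding m_eq[abs_def] by measurable

lemma \<tau>_pos: "0 < \<tau> x"
  using t0 \<tau>_ge by (rule less_le_trans)

lemma m_pos: "0 < m x"
  unfolding m_eq using vol_pos[OF r_pos] \<tau>_pos by simp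

lemma m_ratio_bound: "\<exists>Q. \<forall>x y. m x / m y \<le> Q"
proof -
  obtain v where v: "0 < v" "\<And>x. v \<le> vol \<mu> r x"
    using vol_lower_bound[OF r_pos] by blast
  have "m x / m y \<le> (measure \<mu> UNIV * t1) / (v * t0)" for x y
  proof (rule frac_le)
    show "0 \<le> measure \<mu> UNIV * t1"
      using \<tau>_pos[of x] \<tau>_le[of x] by simp
    show "m x \<le> measure \<mu> UNIV * t1"
      unfolding m_eq using vol_le \<tau>_le \<tau>_pos[of x] by (intro mult_mono) (auto simp: less_imp_le)
    show "v * t0 \<le> m y"
      unfolding m_eq using v \<tau>_ge t0 by (intro mult_mono) (auto intro: order_trans less_imp_le)
  qed (use v t0 in simp)
  then show ?thesis by blast
qed

text \<open>The normalising constant of the transition density, equal to \<open>ball_norm\<close>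
  times the volume of the ball.\<close>

definition mass :: "'a \<Rightarrow> real"
  where "mass x = (\<integral>y. indicator (ball x r) y * (1 + m x / m y) \<partial>\<mu>)"

lemma ball_indicator_meas [measurable]: "(\<lambda>y. indicator (ball x r) y :: real) \<in> borel_measurable borel"
  by (intro borel_measurable_indicator) simp

lemma mass_meas [measurable]: "mass \<in> borel_measurable borel"
  unfolding mass_def[abs_def]
  by (rule borel_measurable_lebesgue_integral) (simp add: case_prod_beta' cong: measurable_cong_sets)

lemma integrand_integrable: "integrable \<mu> (\<lambda>y. indicator (ball x r) y * (1 + m x / m y))"
proof -
  obtain Q where Q: "\<And>x y. m x / m y \<le> Q"
    using m_ratio_bound by blast
  show ?thesis
  proof (rule integrable_const_bound[of _ "1 + Q"])
    show "AE y in \<mu>. norm (indicator (ball x r) y * (1 + m x / m y)) \<le> 1 + Q"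
    proof (rule AE_I2)
      fix y
      have "0 \<le> m x / m y"
        using m_pos by (simp add: less_imp_le)
      then show "norm (indicator (ball x r) y * (1 + m x / m y)) \<le> 1 + Q"
        using Q[of x y] by (auto split: split_indicator)
    qed
  qed measurable
qed

lemma vol_eq_integral: "vol \<mu> r x = (\<integral>y. indicator (ball x r) y \<partial>\<mu>)"
  by (simp add: vol_def Int_absorb2)

lemma vol_le_mass: "vol \<mu> r x \<le> mass x"
  unfolding vol_eq_integral mass_def
proof (rule integral_mono[OF _ integrand_integrable])
  show "indicator (ball x r) y \<le> indicator (ball x r) y * (1 + m x / m y)" for y
    using m_pos[of x] m_pos[of y] by (auto split: split_indicator)
qed (simp add: sets_borel emeasure_eq_measure)

lemma mass_pos: "0 < mass x"
  using vol_pos[OF r_pos] vol_le_mass by (rule less_le_trans)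

lemma ball_norm_eq: "ball_norm \<mu> r m x = mass x / vol \<mu> r x"
  by (simp add: ball_norm_def mass_def vol_def set_lebesgue_integral_def)

lemma ball_norm_meas [measurable]: "ball_norm \<mu> r m \<in> borel_measurable borel"
  unfolding ball_norm_eq[abs_def] by measurable

lemma ball_norm_ge_1: "1 \<le> ball_norm \<mu> r m x"
  unfolding ball_norm_eq using vol_pos[OF r_pos, of x] vol_le_mass[of x] by simp

lemma ball_norm_bound: "\<exists>Q. \<forall>x. ball_norm \<mu> r m x \<le> Q"
proof -
  obtain Q where Q: "\<And>x y. m x / m y \<le> Q"
    using m_ratio_bound by blast
  have "mass x \<le> (\<integral>y. (1 + Q) * indicator (ball x r) y \<partial>\<mu>)" for x
    unfolding mass_def
  proof (rule integral_mono[OF integrand_integrable])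
    show "indicator (ball x r) y * (1 + m x / m y) \<le> (1 + Q) * indicator (ball x r) y" for y
      using Q[of x y] by (auto split: split_indicator)
  qed (simp add: sets_borel emeasure_eq_measure)
  then have "ball_norm \<mu> r m x \<le> 1 + Q" for x
    unfolding ball_norm_eq using vol_pos[OF r_pos, of x] vol_eq_integral[of x] by (simp add: divide_le_eq)
  then show ?thesis by blast
qed

lemma ball_density_eq: "ball_density \<mu> r m x y = indicator (ball x r) y * (1 + m x / m y) / mass x"
  using vol_pos[OF r_pos, of x] by (simp add: ball_density_def ball_norm_eq vol_def)

lemma ball_density_meas [measurable]:
  "(\<lambda>p. ball_density \<mu> r m (fst p) (snd p)) \<in> borel_measurable (borel \<Otimes>\<^sub>M borel)"
  unfolding ball_density_eq by measurable

lemma ball_density_meas2 [measurable]: "ball_density \<mu> r m x \<in> borel_measurable borel"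
  unfolding ball_density_eq[abs_def] by measurable

lemma ball_density_nonneg: "0 \<le> ball_density \<mu> r m x y"
  unfolding ball_density_eq using m_pos[of x] m_pos[of y] mass_pos[of x]
  by (auto split: split_indicator)

lemma ball_density_bound: "\<exists>K. \<forall>x y. ball_density \<mu> r m x y \<le> K"
proof -
  obtain v where v: "0 < v" "\<And>x. v \<le> vol \<mu> r x"
    using vol_lower_bound[OF r_pos] by blast
  obtain Q where Q: "\<And>x y. m x / m y \<le> Q"
    using m_ratio_bound by blast
  have "ball_density \<mu> r m x y \<le> (1 + Q) / v" for x y
  proof -
    have "0 \<le> m x / m y"
      using m_pos by (simp add: less_imp_le)
    then show ?thesis
      unfolding ball_density_eq using Q[of x y] v(1) order_trans[OF v(2) vol_le_mass]
      by (intro frac_le) (auto split: split_indicator)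
  qed
  then show ?thesis by blast
qed

lemma ball_density_integrable: "integrable \<mu> (ball_density \<mu> r m x)"
  unfolding ball_density_eq[abs_def] by (intro integrable_divide integrand_integrable)

lemma integral_ball_density: "(\<integral>y. ball_density \<mu> r m x y \<partial>\<mu>) = 1"
  unfolding ball_density_eq using mass_pos[of x] by (simp add: mass_def[symmetric])

lemma ball_kernel_meas: "ball_kernel \<mu> r m \<in> borel \<rightarrow>\<^sub>M prob_algebra borel"
proof (rule measurable_prob_algebraI)
  show prob: "prob_space (ball_kernel \<mu> r m x)" for x
  proof (rule prob_spaceI)
    have "(\<integral>\<^sup>+ y. ennreal (ball_density \<mu> r m x y) \<partial>\<mu>) = 1"
      using ball_density_nonneg integral_ball_density
      by (subst nn_integral_eq_integral) (auto simp: ball_density_integrable)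
    then show "emeasure (ball_kernel \<mu> r m x) (space (ball_kernel \<mu> r m x)) = 1"
      by (simp add: ball_kernel_def emeasure_density cong: nn_integral_cong)
  qed
  show "ball_kernel \<mu> r m \<in> borel \<rightarrow>\<^sub>M subprob_algebra borel"
  proof (rule measurable_subprob_algebra)
    show "subprob_space (ball_kernel \<mu> r m x)" for x
      using prob by (rule prob_space_imp_subprob_space)
    show "sets (ball_kernel \<mu> r m x) = sets borel" for x
      by (simp add: ball_kernel_def sets_borel)
    fix A :: "'a set" assume A[measurable]: "A \<in> sets borel"
    have "(\<lambda>x. \<integral>\<^sup>+ y. ennreal (ball_density \<mu> r m x y) * indicator A y \<partial>\<mu>) \<in> borel_measurable borel"
      by (rule borel_measurable_nn_integral) (simp add: case_prod_beta' cong: measurable_cong_sets)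
    then show "(\<lambda>x. emeasure (ball_kernel \<mu> r m x) A) \<in> borel_measurable borel"
      by (simp add: ball_kernel_def emeasure_density sets_borel)
  qed
qed

lemma killed_ball_kernel:
  assumes [measurable]: "f \<in> borel_measurable borel" "B \<in> sets borel"
  shows "killed (ball_kernel \<mu> r m) B f x =
    (\<integral>\<^sup>+ y. ennreal (ball_density \<mu> r m x y) * (indicator B y * f y) \<partial>\<mu>)"
  unfolding killed_def ball_kernel_def by (subst nn_integral_density) auto

section \<open>From the generator to a lower bound on its spectrum\<close>

text \<open>The density has integral 1, so the constant comes out. This brings the generator of the
  jump process into the form \<open>(I - P) / \<tau>\<close>.\<close>

lemma integral_ball_density_diff:
  fixes f :: "'a \<Rightarrow> complex"
  assumes f: "integrable \<mu> f"
  shows "(LINT y:ball x r|\<mu>. ball_density \<mu> r m x y *\<^sub>R (c - f y)) =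
    c - (\<integral>y. ball_density \<mu> r m x y *\<^sub>R f y \<partial>\<mu>)"
proof -
  obtain K where K: "\<And>x y. ball_density \<mu> r m x y \<le> K"
    using ball_density_bound by blast
  have int_f: "integrable \<mu> (\<lambda>y. ball_density \<mu> r m x y *\<^sub>R f y)"
  proof (rule Bochner_Integration.integrable_bound)
    show "integrable \<mu> (\<lambda>y. K *\<^sub>R f y)"
      using f by simp
    have "f \<in> borel_measurable borel"
      using f by (simp add: borel_measurable_integrable flip: measurable_\<mu>_iff)
    then show "(\<lambda>y. ball_density \<mu> r m x y *\<^sub>R f y) \<in> borel_measurable \<mu>"
      unfolding measurable_\<mu>_iff by measurable
    show "AE y in \<mu>. norm (ball_density \<mu> r m x y *\<^sub>R f y) \<le> norm (K *\<^sub>R f y)"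
      using K ball_density_nonneg order_trans[OF ball_density_nonneg K]
      by (intro AE_I2) (auto intro!: mult_right_mono)
  qed
  have "(LINT y:ball x r|\<mu>. ball_density \<mu> r m x y *\<^sub>R (c - f y)) =
      (\<integral>y. ball_density \<mu> r m x y *\<^sub>R c - ball_density \<mu> r m x y *\<^sub>R f y \<partial>\<mu>)"
    unfolding set_lebesgue_integral_def
    by (intro Bochner_Integration.integral_cong)
      (auto simp: ball_density_def scaleR_diff_right split: split_indicator)
  also have "\<dots> = (\<integral>y. ball_density \<mu> r m x y *\<^sub>R c \<partial>\<mu>) - (\<integral>y. ball_density \<mu> r m x y *\<^sub>R f y \<partial>\<mu>)"
    by (intro Bochner_Integration.integral_diff int_f integrable_scaleR_left ball_density_integrable)
  also have "(\<integral>y. ball_density \<mu> r m x y *\<^sub>R c \<partial>\<mu>) = c"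
    using integral_scaleR_left[OF ball_density_integrable, of x c] by (simp add: integral_ball_density)
  finally show ?thesis .
qed

text \<open>Transfers the Neumann series argument from an abstract finite measure to
  \<open>ball_measure\<close> restricted to \<open>B\<close>: a positive supersolution with rate
  \<open>\<theta>\<close> keeps the half plane \<open>Re z < \<theta>\<close> free of
  spectrum.\<close>

lemma resolvent_of_supersolution:
  fixes \<phi> :: "'a \<Rightarrow> real"
  assumes B[measurable]: "B \<in> sets borel" "B \<noteq> {}"
    and \<phi>[measurable]: "\<phi> \<in> borel_measurable borel"
    and c: "0 < c" "\<And>x. x \<in> B \<Longrightarrow> c \<le> \<phi> x" and T: "\<And>x. x \<in> B \<Longrightarrow> \<phi> x \<le> T"
    and super: "\<And>x. x \<in> B \<Longrightarrow>
      (\<integral>y. ball_density \<mu> r m x y * (indicator B y * \<phi> y) \<partial>\<mu>) + \<theta> * \<tau> x * \<phi> x \<le> \<phi> x"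
    and A: "\<And>f x. (\<lambda>y. indicator B y *\<^sub>R f y) \<in> borel_measurable borel \<Longrightarrow>
      integrable \<mu> (\<lambda>y. indicator B y *\<^sub>R f y) \<Longrightarrow> x \<in> B \<Longrightarrow>
      A f x = (1 / \<tau> x) *\<^sub>R (f x - (\<integral>y. ball_density \<mu> r m x y *\<^sub>R (indicator B y *\<^sub>R f y) \<partial>\<mu>))"
    and z: "z \<in> L2_spectrum (restrict_space (ball_measure \<mu> r m) B) A"
  shows "\<theta> \<le> Re z"
proof (rule ccontr)
  assume "\<not> \<theta> \<le> Re z"
  then have z\<theta>: "Re z < \<theta>" by simp
  define q where "q = ball_norm \<mu> r m"
  define M where "M = restrict_space (ball_measure \<mu> r m) B"
  \<comment> \<open>Division by \<open>q\<close> cancels the density of \<open>ball_measure\<close>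
    with respect to \<open>\<mu>\<close>, so that integrating \<open>\<kappa>\<close> against
    \<open>M\<close> applies the killed transition operator. As \<open>q \<ge> 1\<close>, the bound
    on the density is kept.\<close>
  define \<kappa> where "\<kappa> x y = ball_density \<mu> r m x y / q y" for x y
  have q1: "1 \<le> q x" for x
    unfolding q_def by (rule ball_norm_ge_1)
  have q0: "0 < q x" for x
    using q1[of x] by simp
  have [measurable]: "q \<in> borel_measurable borel"
    unfolding q_def by measurable
  have bm: "ball_measure \<mu> r m = density \<mu> (\<lambda>x. ennreal (q x))"
    by (simp add: ball_measure_def q_def)
  have sets_bm: "sets (ball_measure \<mu> r m) = sets borel"
    by (simp add: ball_measure_def sets_borel)
  have B': "B \<inter> space (ball_measure \<mu> r m) \<in> sets (ball_measure \<mu> r m)"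
    using B(1) by (simp add: ball_measure_def sets_borel)
  have space_M: "space M = B"
    by (simp add: M_def space_restrict_space ball_measure_def)
  obtain Q where Q: "\<And>x. q x \<le> Q"
    using ball_norm_bound unfolding q_def by blast
  have fin: "finite_measure M"
  proof -
    have "finite_measure (ball_measure \<mu> r m)"
    proof (rule finite_measureI)
      have "emeasure (ball_measure \<mu> r m) (space (ball_measure \<mu> r m)) = (\<integral>\<^sup>+ x. ennreal (q x) \<partial>\<mu>)"
        by (simp add: bm emeasure_density cong: nn_integral_cong)
      also have "\<dots> \<le> (\<integral>\<^sup>+ x. ennreal Q \<partial>\<mu>)"
        using Q by (intro nn_integral_mono ennreal_leI)
      also have "\<dots> < \<infinity>"
        by (simp add: emeasure_eq_measure ennreal_mult_less_top)
      finally show "emeasure (ball_measure \<mu> r m) (space (ball_measure \<mu> r m)) \<noteq> \<infinity>" by simp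
    qed
    then show ?thesis
      unfolding M_def by (rule finite_measure_restrict_space) (simp add: sets_bm)
  qed
  interpret M: finite_measure M by (rule fin)
  have meas_M: "f \<in> borel_measurable M \<longleftrightarrow> (\<lambda>x. indicator B x *\<^sub>R f x) \<in> borel_measurable borel"
    for f :: "'a \<Rightarrow> 'b::real_normed_vector"
    unfolding M_def by (subst borel_measurable_restrict_space_iff[OF B'])
      (simp add: measurable_cong_sets[OF sets_bm refl])
  have id_meas[measurable]: "(\<lambda>x. x) \<in> M \<rightarrow>\<^sub>M borel"
    unfolding M_def by (rule measurable_restrict_space1) (simp add: measurable_ident_sets[OF sets_bm])
  have borel_M: "f \<in> borel_measurable borel \<Longrightarrow> f \<in> borel_measurable M" for f :: "'a \<Rightarrow> real"
    using measurable_compose[OF id_meas] by auto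
  have integral_M: "(\<integral>y. \<kappa> x y *\<^sub>R f y \<partial>M) = (\<integral>y. ball_density \<mu> r m x y *\<^sub>R (indicator B y *\<^sub>R f y) \<partial>\<mu>)"
    if f: "f \<in> borel_measurable M" for x and f :: "'a \<Rightarrow> 'b::{banach, second_countable_topology}"
  proof -
    have [measurable]: "(\<lambda>x. indicator B x *\<^sub>R f x) \<in> borel_measurable borel"
      using f by (simp add: meas_M)
    have "(\<integral>y. \<kappa> x y *\<^sub>R f y \<partial>M) = (\<integral>y. \<kappa> x y *\<^sub>R (indicator B y *\<^sub>R f y) \<partial>ball_measure \<mu> r m)"
      unfolding M_def by (subst integral_restrict_space[OF B']) (simp add: mult.commute)
    also have "\<dots> = (\<integral>y. q y *\<^sub>R (\<kappa> x y *\<^sub>R (indicator B y *\<^sub>R f y)) \<partial>\<mu>)"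
    proof -
      have "(\<lambda>y. \<kappa> x y *\<^sub>R (indicator B y *\<^sub>R f y)) \<in> borel_measurable borel"
        unfolding \<kappa>_def by measurable
      then show ?thesis
        unfolding bm using q0 by (subst integral_density) (auto simp: less_imp_le measurable_\<mu>_iff)
    qed
    also have "\<dots> = (\<integral>y. ball_density \<mu> r m x y *\<^sub>R (indicator B y *\<^sub>R f y) \<partial>\<mu>)"
      using q0 by (intro Bochner_Integration.integral_cong) (auto simp: \<kappa>_def less_imp_neq[symmetric])
    finally show ?thesis .
  qed
  obtain K where K: "\<And>x y. ball_density \<mu> r m x y \<le> K"
    using ball_density_bound by blast
  have "z \<in> L2_resolvent M A"
  proof (rule L2_resolvent_Neumann[where \<kappa> = \<kappa> and K = K and D = "\<lambda>x. 1 / \<tau> x" and Q = "1 / t0" and \<phi> = \<phi> and T = T and c = c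
        and \<theta> = \<theta>, OF fin])
    show "space M \<noteq> {}" using B(2) space_M by simp
    have "(\<lambda>p. ball_density \<mu> r m (fst p) (snd p) / q (snd p)) \<in> borel_measurable (borel \<Otimes>\<^sub>M borel)"
      by measurable
    then show "(\<lambda>(x, y). \<kappa> x y) \<in> borel_measurable (M \<Otimes>\<^sub>M M)"
      unfolding \<kappa>_def case_prod_beta'
    proof (rule measurable_compose[rotated])
      show "(\<lambda>p. p) \<in> M \<Otimes>\<^sub>M M \<rightarrow>\<^sub>M borel \<Otimes>\<^sub>M borel"
        using measurable_compose[OF measurable_fst id_meas] measurable_compose[OF measurable_snd id_meas]
        by (intro measurable_pair) (simp_all add: comp_def)
    qed
    show "0 \<le> \<kappa> x y" for x y
      using ball_density_nonneg q0[of y] by (simp add: \<kappa>_def)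
    show "\<kappa> x y \<le> K" for x y
    proof -
      have "\<kappa> x y \<le> ball_density \<mu> r m x y"
        unfolding \<kappa>_def using divide_left_mono[OF q1[of y] ball_density_nonneg[of x y]] q0[of y] by simp
      then show ?thesis using K by (rule order_trans)
    qed
    show "(\<lambda>x. 1 / \<tau> x) \<in> borel_measurable M" "\<phi> \<in> borel_measurable M"
      by (auto intro!: borel_M)
    show "0 \<le> 1 / \<tau> x" "1 / \<tau> x \<le> 1 / t0" for x
      using \<tau>_pos[of x] \<tau>_ge[of x] t0 by (auto intro: frac_le)
    show "0 < c" by fact
    show "c \<le> \<phi> x" "\<phi> x \<le> T" if "x \<in> space M" for x
      using that c T by (auto simp: space_M)
    show "1 / \<tau> x * (\<integral>y. \<kappa> x y * \<phi> y \<partial>M) + \<theta> * \<phi> x \<le> 1 / \<tau> x * \<phi> x" if "x \<in> space M" for x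
    proof -
      have "(\<integral>y. \<kappa> x y * \<phi> y \<partial>M) = (\<integral>y. ball_density \<mu> r m x y * (indicator B y * \<phi> y) \<partial>\<mu>)"
        using integral_M[of \<phi> x] by (simp add: borel_M)
      then have "1 / \<tau> x * ((\<integral>y. \<kappa> x y * \<phi> y \<partial>M) + \<theta> * \<tau> x * \<phi> x) \<le> 1 / \<tau> x * \<phi> x"
        using super[of x] that \<tau>_pos[of x] by (intro mult_left_mono) (auto simp: space_M)
      then show ?thesis
        using \<tau>_pos[of x] by (simp add: field_simps)
    qed
    show "A f x = (1 / \<tau> x) *\<^sub>R (f x - (\<integral>y. \<kappa> x y *\<^sub>R f y \<partial>M))"
      if f: "f \<in> L2_fun M" and x: "x \<in> space M" for f x
    proof -
      have fM: "f \<in> borel_measurable M"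
        using f by (simp add: L2_fun_def)
      then have m': "(\<lambda>y. indicator B y *\<^sub>R f y) \<in> borel_measurable borel"
        by (simp add: meas_M)
      have "integrable (ball_measure \<mu> r m) (\<lambda>y. indicator B y *\<^sub>R f y)"
        using M.L2_fun_integrable[OF f] unfolding M_def by (subst (asm) integrable_restrict_space[OF B'])
      then have "integrable \<mu> (\<lambda>y. q y *\<^sub>R (indicator B y *\<^sub>R f y))"
        unfolding bm using m' q0 by (subst (asm) integrable_density) (auto simp: less_imp_le measurable_\<mu>_iff)
      \<comment> \<open>From \<open>q \<ge> 1\<close>, integrability for \<open>ball_measure\<close>
        passes to \<open>\<mu>\<close>.\<close>
      then have "integrable \<mu> (\<lambda>y. indicator B y *\<^sub>R f y)"
      proof (rule Bochner_Integration.integrable_bound)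
        show "AE y in \<mu>. norm (indicator B y *\<^sub>R f y) \<le> norm (q y *\<^sub>R (indicator B y *\<^sub>R f y))"
        proof (rule AE_I2)
          fix y
          show "norm (indicator B y *\<^sub>R f y) \<le> norm (q y *\<^sub>R (indicator B y *\<^sub>R f y))"
            using mult_right_mono[OF q1[of y], of "norm (indicator B y *\<^sub>R f y)"] q0[of y] by simp
        qed
      qed (use m' in \<open>simp add: measurable_\<mu>_iff\<close>)
      from A[OF m' this] x integral_M[OF fM, of x] show ?thesis
        by (simp add: space_M)
    qed
  qed (rule z\<theta>)
  then show False
    using z by (simp add: L2_spectrum_def M_def)
qed

text \<open>The Green function is the supersolution. Here \<open>E\<close> is any bound for it on
  \<open>B\<close>, so each walk can supply its own exit time estimate.\<close>

lemma spectrum_bottom_ge_inverse_exit_time: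
  assumes B[measurable]: "B \<in> sets borel" "B \<noteq> {}"
    and A: "\<And>f x. (\<lambda>y. indicator B y *\<^sub>R f y) \<in> borel_measurable borel \<Longrightarrow>
      integrable \<mu> (\<lambda>y. indicator B y *\<^sub>R f y) \<Longrightarrow> x \<in> B \<Longrightarrow>
      A f x = (1 / \<tau> x) *\<^sub>R (f x - (\<integral>y. ball_density \<mu> r m x y *\<^sub>R (indicator B y *\<^sub>R f y) \<partial>\<mu>))"
    and E: "\<And>x. x \<in> B \<Longrightarrow> (\<Sum>n. (killed (ball_kernel \<mu> r m) B ^^ n) (\<lambda>y. ennreal (\<tau> y)) x) \<le> E"
  shows "ereal 1 / enn2ereal E \<le> spectrum_bottom (restrict_space (ball_measure \<mu> r m) B) A"
proof -
  note resolvent = resolvent_of_supersolution[OF B _ _ _ _ _ A]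
  have \<tau>'[measurable]: "(\<lambda>y. ennreal (\<tau> y)) \<in> borel_measurable borel"
    by measurable
  define G where "G x = (\<Sum>n. (killed (ball_kernel \<mu> r m) B ^^ n) (\<lambda>y. ennreal (\<tau> y)) x)" for x
  have G_meas[measurable]: "G \<in> borel_measurable borel"
    unfolding G_def using measurable_killed_iterate[OF ball_kernel_meas B(1) \<tau>'] by measurable
  have G: "G x = ennreal (\<tau> x) + (\<integral>\<^sup>+ y. ennreal (ball_density \<mu> r m x y) * (indicator B y * G y) \<partial>\<mu>)" for x
    using sum_killed_fixpoint[OF ball_kernel_meas B(1) \<tau>', of x] killed_ball_kernel[OF G_meas B(1), of x]
    unfolding G_def by simp
  show ?thesis
  proof (cases E)
    case top
    \<comment> \<open>With \<open>E = \<infinity>\<close> the quotient is 0, and the constant 1 is a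
      supersolution with rate 0 because the density has integral 1.\<close>
    have "0 \<le> Re z" if "z \<in> L2_spectrum (restrict_space (ball_measure \<mu> r m) B) A" for z
    proof (rule resolvent[OF _ _ _ _ _ _ _ _ that, where \<phi> = "\<lambda>_. 1" and c = 1 and T = 1])
      show "(\<integral>y. ball_density \<mu> r m x y * (indicator B y * 1) \<partial>\<mu>) + 0 * \<tau> x * 1 \<le> 1" for x
      proof -
        have "(\<integral>y. ball_density \<mu> r m x y * (indicator B y * 1) \<partial>\<mu>) \<le> (\<integral>y. ball_density \<mu> r m x y \<partial>\<mu>)"
        proof (rule integral_mono_AE')
          show "AE y in \<mu>. ball_density \<mu> r m x y * (indicator B y * 1) \<le> ball_density \<mu> r m x y"
            using ball_density_nonneg by (auto split: split_indicator)
        qed (auto simp: ball_density_integrable ball_density_nonneg)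
        then show ?thesis by (simp add: integral_ball_density)
      qed
    qed auto
    then show ?thesis
      unfolding spectrum_bottom_def top by (intro INF_greatest) simp
  next
    case (real T)
    \<comment> \<open>The real version of \<open>G\<close>. Finiteness of \<open>G\<close> is known
      on \<open>B\<close> only, hence the cutoff.\<close>
    define \<phi> where "\<phi> x = enn2real (indicator B x * G x)" for x
    have [measurable]: "\<phi> \<in> borel_measurable borel"
      unfolding \<phi>_def[abs_def] by measurable
    have GT: "G x \<le> ennreal T" if "x \<in> B" for x
      using E[OF that] real by (simp add: G_def)
    have \<phi>G: "ennreal (\<phi> x) = G x" if "x \<in> B" for x
      using GT[OF that] that by (simp add: \<phi>_def ennreal_enn2real le_less_trans[OF _ ennreal_less_top])
    have \<phi>_nonneg: "0 \<le> \<phi> x" for x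
      by (simp add: \<phi>_def)
    have \<phi>T: "\<phi> x \<le> T" if "x \<in> B" for x
      using GT[OF that] \<phi>G[OF that] real by (metis ennreal_le_iff)
    have \<phi>: "\<phi> x = \<tau> x + (\<integral>y. ball_density \<mu> r m x y * (indicator B y * \<phi> y) \<partial>\<mu>)" if x: "x \<in> B" for x
    proof -
      let ?I = "\<integral>\<^sup>+ y. ennreal (ball_density \<mu> r m x y) * (indicator B y * G y) \<partial>\<mu>"
      have "?I = (\<integral>\<^sup>+ y. ennreal (ball_density \<mu> r m x y * (indicator B y * \<phi> y)) \<partial>\<mu>)"
        using \<phi>G ball_density_nonneg \<phi>_nonneg
        by (intro nn_integral_cong) (auto simp: ennreal_mult split: split_indicator)
      then have "(\<integral>y. ball_density \<mu> r m x y * (indicator B y * \<phi> y) \<partial>\<mu>) = enn2real ?I"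
        using ball_density_nonneg \<phi>_nonneg
        by (subst integral_eq_nn_integral) (auto cong: measurable_cong_sets)
      \<comment> \<open>Finiteness makes \<open>enn2real\<close> faithful on \<open>?I\<close>, so
        the fixpoint equation for \<open>G\<close> carries over to real numbers.\<close>
      moreover have "?I < top"
      proof -
        have "?I \<le> ennreal (\<tau> x) + ?I"
          by (simp add: add_increasing)
        also have "\<dots> \<le> ennreal T"
          using GT[OF x] unfolding G[of x] .
        also have "\<dots> < top" by simp
        finally show ?thesis .
      qed
      ultimately have "ennreal (\<phi> x) = ennreal (\<tau> x + (\<integral>y. ball_density \<mu> r m x y * (indicator B y * \<phi> y) \<partial>\<mu>))"
        unfolding \<phi>G[OF x] G[of x] using \<tau>_pos[of x] by (simp add: ennreal_plus ennreal_enn2real less_imp_le)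
      moreover have "0 \<le> \<tau> x + (\<integral>y. ball_density \<mu> r m x y * (indicator B y * \<phi> y) \<partial>\<mu>)"
        using \<tau>_pos[of x] ball_density_nonneg \<phi>_nonneg by (intro add_nonneg_nonneg integral_nonneg_AE) (auto simp: less_imp_le)
      ultimately show ?thesis
        using \<phi>_nonneg by simp
    qed
    \<comment> \<open>The first term of the Green function already gives the positive lower bound
      that a supersolution must have.\<close>
    have \<phi>\<tau>: "t0 \<le> \<phi> x" if "x \<in> B" for x
    proof -
      have "0 \<le> (\<integral>y. ball_density \<mu> r m x y * (indicator B y * \<phi> y) \<partial>\<mu>)"
        using ball_density_nonneg \<phi>_nonneg by (intro integral_nonneg_AE) auto
      then show ?thesis
        using \<phi>[OF that] \<tau>_ge[of x] by linarith
    qed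
    obtain w where "w \<in> B" using B(2) by blast
    then have T: "0 < T"
      using \<phi>T[of w] \<phi>\<tau>[of w] t0 by linarith
    have "1 / T \<le> Re z" if "z \<in> L2_spectrum (restrict_space (ball_measure \<mu> r m) B) A" for z
    proof (rule resolvent[OF _ t0 _ _ _ _ _ _ that, where \<phi> = \<phi> and T = T])
      show "(\<integral>y. ball_density \<mu> r m x y * (indicator B y * \<phi> y) \<partial>\<mu>) + 1 / T * \<tau> x * \<phi> x \<le> \<phi> x"
        if x: "x \<in> B" for x
      proof -
        \<comment> \<open>From \<open>\<phi> \<le> T\<close> on \<open>B\<close>; together with the
          equation \<open>\<phi> = \<tau> + P \<phi>\<close> this is the supersolution inequality
          with rate \<open>1 / T\<close>.\<close>
        have "1 / T * \<tau> x * \<phi> x \<le> \<tau> x"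
          using \<phi>T[OF x] T \<tau>_pos[of x] by (simp add: field_simps)
        then show ?thesis
          using \<phi>[OF x] by linarith
      qed
    qed (use \<phi>\<tau> \<phi>T in auto)
    moreover have "ereal 1 / enn2ereal E = ereal (1 / T)"
      using real T by (simp add: enn2ereal_ennreal)
    ultimately show ?thesis
      unfolding spectrum_bottom_def by (intro INF_greatest) simp
  qed
qed

end

section \<open>Spectral bounds for the two walks\<close>

context compact_full_support
begin

lemma ball_walk_vol: "0 < r \<Longrightarrow> ball_walk \<mu> r (\<lambda>_. 1) (vol \<mu> r) 1 1"
  by unfold_locales auto

lemma sigma_bottom_ge:
  assumes r: "0 < r" and B: "B \<in> sets borel" "B \<noteq> {}"
  shows "ereal 1 / enn2ereal (max_mean_exit \<mu> r B) \<le> sigma_bottom \<mu> r B"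
proof -
  interpret ball_walk \<mu> r "\<lambda>_. 1" "vol \<mu> r" 1 1
    using r by (rule ball_walk_vol)
  show ?thesis
    unfolding sigma_bottom_def nu_measure_def
  proof (rule spectrum_bottom_ge_inverse_exit_time[OF B])
    show "compress B (\<lambda>f x. f x - W_op \<mu> r f x) f x =
        (1 / 1) *\<^sub>R (f x - (\<integral>y. ball_density \<mu> r (vol \<mu> r) x y *\<^sub>R (indicator B y *\<^sub>R f y) \<partial>\<mu>))"
      if "x \<in> B" for f x
      using that by (simp add: compress_def W_op_def scaleR_conv_of_real of_real_indicator)
    show "(\<Sum>n. (killed (ball_kernel \<mu> r (vol \<mu> r)) B ^^ n) (\<lambda>y. ennreal 1) x) \<le> max_mean_exit \<mu> r B"
      if "x \<in> B" for x
    proof -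
      have "(\<Sum>n. (killed (ball_kernel \<mu> r (vol \<mu> r)) B ^^ n) (\<lambda>y. ennreal 1) x) \<le> mean_exit \<mu> r B x"
        unfolding mean_exit_def using nn_integral_chain_exit_time_ge[OF ball_kernel_meas B(1) that] by simp
      also have "\<dots> \<le> max_mean_exit \<mu> r B"
        unfolding max_mean_exit_def using that by (rule SUP_upper)
      finally show ?thesis .
    qed
  qed
qed

text \<open>As \<open>beta\<close> takes values between 0 and \<open>b\<close>, the holding time
  lies between 1 and \<open>r powr b\<close>, in an order depending on whether
  \<open>r \<le> 1\<close>; \<open>min\<close> and \<open>max\<close> cover both cases.\<close>

lemma ball_walk_d_weight:
  assumes r: "0 < r" and b: "\<And>x. beta \<mu> x \<le> b"
  shows "ball_walk \<mu> r (\<lambda>x. r powr beta \<mu> x) (d_weight \<mu> r) (min 1 (r powr b)) (max 1 (r powr b))"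
proof
  have \<beta>: "0 \<le> beta \<mu> x" for x
    by (simp add: beta_def)
  show "min 1 (r powr b) \<le> r powr beta \<mu> x" for x
    using r powr_mono[OF \<beta>[of x], of r] powr_mono'[OF b[of x], of r] by (cases "r \<le> 1") auto
  show "r powr beta \<mu> x \<le> max 1 (r powr b)" for x
    using r powr_mono'[OF \<beta>[of x], of r] powr_mono[OF b[of x], of r]
    by (cases "r \<le> 1") (auto simp: le_max_iff_disj)
  show "d_weight \<mu> r x = vol \<mu> r x * r powr beta \<mu> x" for x
    by (simp add: d_weight_def vol_def)
qed (use r in auto)

text \<open>Stated for any bound \<open>E\<close> on the maximal mean exit time, so that an estimate
  valid for small \<open>r\<close> can be inserted.\<close>

lemma lambda_bottom_ge:
  assumes r: "0 < r" and b: "\<And>x. beta \<mu> x \<le> b" and B: "B \<in> sets borel" "B \<noteq> {}"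
    and E: "max_mean_exit_ct \<mu> r B \<le> E"
  shows "ereal 1 / enn2ereal E \<le> lambda_bottom \<mu> r B"
proof -
  interpret ball_walk \<mu> r "\<lambda>x. r powr beta \<mu> x" "d_weight \<mu> r" "min 1 (r powr b)" "max 1 (r powr b)"
    using r b by (rule ball_walk_d_weight)
  show ?thesis
    unfolding lambda_bottom_def mu_measure_def
  proof (rule spectrum_bottom_ge_inverse_exit_time[OF B])
    show "compress B (L_op \<mu> r) f x = (1 / r powr beta \<mu> x) *\<^sub>R
        (f x - (\<integral>y. ball_density \<mu> r (d_weight \<mu> r) x y *\<^sub>R (indicator B y *\<^sub>R f y) \<partial>\<mu>))"
      if f: "integrable \<mu> (\<lambda>y. indicator B y *\<^sub>R f y)" and x: "x \<in> B" for f x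
    proof -
      have *: "(\<lambda>y. indicator B y * f y) = (\<lambda>y. indicator B y *\<^sub>R f y)"
        by (simp add: scaleR_conv_of_real of_real_indicator)
      show ?thesis
        unfolding compress_def * L_op_def integral_ball_density_diff[OF f] using x by simp
    qed
    show "(\<Sum>n. (killed (ball_kernel \<mu> r (d_weight \<mu> r)) B ^^ n) (\<lambda>y. ennreal (r powr beta \<mu> y)) x) \<le> E"
      if "x \<in> B" for x
    proof -
      have "(\<Sum>n. (killed (ball_kernel \<mu> r (d_weight \<mu> r)) B ^^ n) (\<lambda>y. ennreal (r powr beta \<mu> y)) x) \<le>
          mean_exit_ct \<mu> r B x"
        unfolding mean_exit_ct_def
        by (rule nn_integral_jump_exit_time_ge[OF ball_kernel_meas B(1) _ _ that]) auto
      also have "\<dots> \<le> max_mean_exit_ct \<mu> r B"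
        unfolding max_mean_exit_ct_def using that by (rule SUP_upper)
      finally show ?thesis using E by (rule order_trans)
    qed
  qed
qed

lemma beta_bounded:
  assumes "time_exponent_bounded \<mu>"
  shows "\<exists>b. \<forall>x. beta \<mu> x \<le> b"
proof -
  obtain b where b: "\<And>x. time_exponent \<mu> x \<le> ennreal b"
    using assms unfolding time_exponent_bounded_def by blast
  have "beta \<mu> x \<le> max 0 b" for x
    unfolding beta_def
    by (rule enn2real_leI) (use b[of x] in \<open>auto intro: order_trans[OF _ ennreal_leI]\<close>)
  then show ?thesis by blast
qed

lemma lambda_bottom_ge_scale:
  fixes x0 :: 'a
  assumes "time_exponent_bounded \<mu>" and C: "0 < C" and R: "0 < R"
    and T: "T_scale \<mu> (cball x0 R) \<le> ennreal (C * R powr beta \<mu> x0)"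
  shows "\<exists>r0>0. \<forall>r. 0 < r \<and> r < r0 \<longrightarrow>
    ereal (1 / (2 * C) / R powr beta \<mu> x0) \<le> lambda_bottom \<mu> r (cball x0 R)"
proof -
  \<comment> \<open>The factor 2 puts \<open>E\<close> strictly above the upper limit of the exit
    times, so for all small \<open>r\<close> the exit time itself is below \<open>E\<close>.\<close>
  define E where "E = 2 * C * R powr beta \<mu> x0"
  have "0 < E" "C * R powr beta \<mu> x0 < E"
    using C R by (auto simp: E_def)
  then have "ennreal (C * R powr beta \<mu> x0) < ennreal E"
    using C by (intro ennreal_lessI) auto
  with T have "Limsup (at_right 0) (\<lambda>r. max_mean_exit_ct \<mu> r (cball x0 R)) < ennreal E"
    unfolding T_scale_def by (rule le_less_trans)
  then have "\<forall>\<^sub>F r in at_right 0. max_mean_exit_ct \<mu> r (cball x0 R) < ennreal E"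
    by (rule Limsup_lessD)
  then obtain r0 where r0: "0 < r0" "\<And>r. 0 < r \<Longrightarrow> r < r0 \<Longrightarrow> max_mean_exit_ct \<mu> r (cball x0 R) < ennreal E"
    unfolding eventually_at_right_field by blast
  obtain b where b: "\<And>x. beta \<mu> x \<le> b"
    using beta_bounded[OF assms(1)] by blast
  have "ereal (1 / (2 * C) / R powr beta \<mu> x0) \<le> lambda_bottom \<mu> r (cball x0 R)"
    if r: "0 < r" "r < r0" for r
  proof -
    have "ereal (1 / (2 * C) / R powr beta \<mu> x0) = ereal 1 / enn2ereal (ennreal E)"
      using \<open>0 < E\<close> C R by (simp add: enn2ereal_ennreal E_def)
    also have "\<dots> \<le> lambda_bottom \<mu> r (cball x0 R)"
      using R r0(2)[OF r] by (intro lambda_bottom_ge[OF r(1) b]) (auto simp: less_imp_le)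
    finally show ?thesis .
  qed
  with r0(1) show ?thesis by blast
qed

end

theorem theorem4p4p5:
  fixes \<mu> :: "'a::metric_space measure"
  assumes "compact (UNIV :: 'a set)" and "connected (UNIV :: 'a set)"
    and "\<exists>x y :: 'a. x \<noteq> y"
    and "finite_measure \<mu>" and "sets \<mu> = sets borel"
    and "\<forall>x r. 0 < r \<longrightarrow> 0 < emeasure \<mu> (ball x r)"
  shows
    "(\<exists>c::real. 0 < c \<and>
       (\<forall>(x0::'a) R. 0 < R \<and> R < diameter (UNIV :: 'a set) / 2 \<longrightarrow>
         (\<exists>r0>0. \<forall>r. 0 < r \<and> r < r0 \<longrightarrow>
            ereal c / enn2ereal (max_mean_exit \<mu> r (cball x0 R)) \<le> sigma_bottom \<mu> r (cball x0 R))))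
     \<and>
     (time_exponent_bounded \<mu> \<and> variable_time_regular \<mu> \<longrightarrow>
       (\<exists>c::real. 0 < c \<and>
         (\<forall>(x0::'a) R. 0 < R \<and> R < diameter (UNIV :: 'a set) / 2 \<longrightarrow>
           (\<exists>r0>0. \<forall>r. 0 < r \<and> r < r0 \<longrightarrow>
              ereal (c / R powr beta \<mu> x0) \<le> lambda_bottom \<mu> r (cball x0 R)))))"
proof -
  interpret compact_full_support \<mu>
    using assms by (auto simp: compact_full_support_def compact_full_support_axioms_def)
  show ?thesis
  proof (intro conjI impI)
    show "\<exists>c::real. 0 < c \<and>
       (\<forall>(x0::'a) R. 0 < R \<and> R < diameter (UNIV :: 'a set) / 2 \<longrightarrow>
         (\<exists>r0>0. \<forall>r. 0 < r \<and> r < r0 \<longrightarrow>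
            ereal c / enn2ereal (max_mean_exit \<mu> r (cball x0 R)) \<le> sigma_bottom \<mu> r (cball x0 R)))"
    proof (rule exI[of _ 1], intro conjI allI impI)
      fix x0 :: 'a and R :: real assume R: "0 < R \<and> R < diameter (UNIV :: 'a set) / 2"
      have "ereal 1 / enn2ereal (max_mean_exit \<mu> r (cball x0 R)) \<le> sigma_bottom \<mu> r (cball x0 R)"
        if "0 < r" for r
        using R by (intro sigma_bottom_ge that) auto
      then show "\<exists>r0>0. \<forall>r. 0 < r \<and> r < r0 \<longrightarrow>
          ereal 1 / enn2ereal (max_mean_exit \<mu> r (cball x0 R)) \<le> sigma_bottom \<mu> r (cball x0 R)"
        \<comment> \<open>The bound holds for every positive \<open>r\<close>, so any
          \<open>r0\<close> will do.\<close>
        by (intro exI[of _ 1]) simp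
    qed simp
  next
    assume reg: "time_exponent_bounded \<mu> \<and> variable_time_regular \<mu>"
    then obtain C where C: "0 < C" "\<And>x R. 0 < R \<Longrightarrow> R < diameter (UNIV :: 'a set) / 2 \<Longrightarrow>
        T_scale \<mu> (cball x R) \<le> ennreal (C * R powr beta \<mu> x)"
      unfolding variable_time_regular_def by blast
    show "\<exists>c::real. 0 < c \<and>
         (\<forall>(x0::'a) R. 0 < R \<and> R < diameter (UNIV :: 'a set) / 2 \<longrightarrow>
           (\<exists>r0>0. \<forall>r. 0 < r \<and> r < r0 \<longrightarrow>
              ereal (c / R powr beta \<mu> x0) \<le> lambda_bottom \<mu> r (cball x0 R)))"
      \<comment> \<open>The constant \<open>1 / (2 * C)\<close> depends only on the regularity
        constant \<open>C\<close>, not on the centre or the radius.\<close>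
      using reg C by (intro exI[of _ "1 / (2 * C)"] conjI allI impI lambda_bottom_ge_scale) auto
  qed
qed

end
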